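(* Let $(\widetilde H/\widetilde K,\widetilde P)$ be a flat $k$-reductive $\widetilde G$-structure on a homogeneous manifold $\widetilde M=\widetilde H/\widetilde K$ of dimension $\widetilde n$ and let $\pi:P\to M$ be a $G$-structure on a manifold $M$ of dimension $n$ with $G\simeq G_\sharp/N_\sharp$. Assume that $P$ is locally immersible in $\widetilde P$ to order $p$ and, for any admissible tuple $(s,\omega^0,\dots,\omega^{p-1})$ on some open set $\mathcal U\subset M$, use the frames $s_x$, $x\in\mathcal U$, to identify the tangent spaces $T_xM$ with $W$. Then: (i) for any admissible $(s,\omega^0,\dots,\omega^{p-1})$, the associated total $(G,\widetilde G)$-curvature tensors $\Omega^{p-1}|_x\in\widetilde{\mathfrak h}^{p-1}\otimes\Lambda^2T_x^*M\simeq C^{p,2}(\widetilde{\mathfrak h},W)$ satisfy $\partial(\Omega^{p-1}|_x)=0$, and $\partial(\widehat\Omega^{p-1}_r|_x)=0$ for all projections $\widehat\Omega^{p-1}_r|_x\in C^{p,2}_r(\widetilde{\mathfrak h},W)$, $1\le r\le p$; (ii) $P$ is locally immersible in $\widetilde P$ to order $p+1$ if and only if, around any point $x_o\in M$, there exists an admissible tuple $(s,\omega^0,\dots,\omega^{p-1})$ such that the class $[\Omega^{p-1}|_x]\in H^{p,2}(\widetilde{\mathfrak h},W)$ is zero at any $x$ where it is defined.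
   Context: All objects are smooth. For a closed subgroup $G\subset\mathrm{GL}_n(\mathbb R)$, a $G$-structure on an $n$-manifold $M$ is a $G$-reduction $\pi:P\to M$ of the linear frame bundle $L(M)$; its soldering form $\vartheta=(\vartheta^1,\dots,\vartheta^n)$ assigns to $v\in T_uP$ the components of $\pi_*v$ in the frame $u$. Flat $k$-reductive structures. $\widetilde M=\widetilde H/\widetilde K$ is a homogeneous manifold of dimension $\widetilde n\ge n$ with effective action, $\widetilde H$ connected and simply connected, $\widetilde K$ connected, $o=e\widetilde K$; $u_o$ is a fixed frame at $o$, identifying $T_o\widetilde M=\widetilde{\mathfrak h}/\widetilde{\mathfrak k}$ with $\mathbb R^{\widetilde n}$ (where $\widetilde{\mathfrak h}=Lie(\widetilde H)$, $\widetilde{\mathfrak k}=Lie(\widetilde K)$); $\widetilde P=\widetilde H\cdot u_o\subset L(\widetilde M)$, with structure group $\widetilde G\subset\mathrm{GL}_{\widetilde n}(\mathbb R)$ equal to the image of the isotropy representation of $\widetilde K$. It is flat $k$-reductive if $\widetilde{\mathfrak h}=\sum_{p=-1}^{k-1}\widetilde{\mathfrak h}^p$ is a graded Lie algebra, $[\widetilde{\mathfrak h}^r,\widetilde{\mathfrak h}^s]\subset\widetilde{\mathfrak h}^{r+s}$ for all $r,s$ (with $\widetilde{\mathfrak h}^p=0$ if $p\notin\{-1,\dots,k-1\}$), and $\widetilde{\mathfrak k}=\sum_{p=0}^{k-1}\widetilde{\mathfrak h}^p$. Put $V=\mathbb R^{\widetilde n}\simeq\widetilde{\mathfrak h}^{-1}$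 and let $W\simeq\mathbb R^n\subset V$ be the subspace where the last $\widetilde n-n$ coordinates vanish. $G_\sharp\subset\widetilde G$ is the subgroup of block matrices $\begin{pmatrix}A&B\\0&D\end{pmatrix}\in\widetilde G$ with $A$ of size $n\times n$, and $N_\sharp$ its normal subgroup of those with $A=I$. $G\simeq G_\sharp/N_\sharp$ means that $G$ is the group of upper left blocks $A$ of elements of $G_\sharp$. Conventions: for Lie algebra valued $1$-forms $[\alpha,\beta](X,Y)=[\alpha(X),\beta(Y)]-[\alpha(Y),\beta(X)]$. Admissible tuples. An admissible tuple $(s,\omega^0,\dots,\omega^{p-1})$ on an open $\mathcal U\subset M$ consists of a section $s:\mathcal U\to P$ and $\widetilde{\mathfrak h}^r$-valued $1$-forms $\omega^r$ on $\mathcal U$ such that, with $\omega^{-1}=(s^*\vartheta^1,\dots,s^*\vartheta^n,0,\dots,0)$ ($\widetilde{\mathfrak h}^{-1}$-valued), $$d\omega^{q-1}+\tfrac12\sum_{r=0}^{q-1}[\omega^r,\omega^{q-1-r}]=-[\omega^{-1},\omega^q],\qquad 0\le q\le p-1 .$$ (For $q\geq k$ one has $\omega^q=0$.) $P$ is locally immersible in $\widetilde P$ to order $p$ if around any point of $M$ there is such an admissible tuple. The total $(G,\widetilde G)$-curvature of order $p+1$ of the tuple is the $\widetilde{\mathfrak h}^{p-1}$-valued $2$-form $$\Omega^{p-1}=d\omega^{p-1}+\tfrac12\sum_{r=0}^{p-1}[\omega^r,\omega^{p-1-r}] .$$ Annihilators. For $0\le r\le p$, $\mathfrak c^{p-1}_r=\{X\in\widetilde{\mathfrak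 h}^{p-1}:[\dots[[X,w_1],w_2]\dots,w_r]=0\ \forall w_i\in W\}$ (so $\mathfrak c_0^{p-1}=0$), and $\mathfrak c^{p-1}_{r}=\widetilde{\mathfrak h}^{p-1}$ for $r\ge p+1$. $p'_r:\widetilde{\mathfrak h}^{p-1}\to\widetilde{\mathfrak h}^{p-1}/\mathfrak c^{p-1}_r$ is the projection for $p\ge1$, and the identity on $\widetilde{\mathfrak h}^{-1}=V$. The curvature of level $r$ is $\widehat\Omega^{p-1}_r=p'_r\circ\Omega^{p-1}$. Cohomology. $C^{0,q}_r(\widetilde{\mathfrak h},W)=V\otimes\Lambda^qW^*$, $C^{p+1,q}_r(\widetilde{\mathfrak h},W)=(\widetilde{\mathfrak h}^p/\mathfrak c^p_r)\otimes\Lambda^qW^*$ for $p\ge0$; $\partial:C^{p,q}_r\to C^{p-1,q+1}_r$ is $$\partial c(w_1,\dots,w_{q+1})=\sum_{i=1}^{q+1}(-1)^i\,p'_r\circ[c(w_1,\dots,\widehat{w_i},\dots,w_{q+1}),w_i]$$ (with $\partial=0$ on $C^{0,q}_r$), which satisfies $\partial^2=0$; $H^{p,q}_r(\widetilde{\mathfrak h},W)$ is the corresponding cohomology group (cocycles in $C^{p,q}_r$ modulo coboundaries). When the subscript $r$ is omitted, $r=0$. *)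

theory Defs
  imports
    "HOL-Analysis.Analysis"
    "HOL-Algebra.Group_Action"
    "HOL-Library.Set_Algebras"
begin

section \<open>Smooth manifolds, tangent vectors, smooth maps\<close>

text \<open>Only used on open sets; a map between finite-dimensional spaces is C^k iff all its iterated
  directional derivatives of order at most k exist and are continuous.\<close>

primrec Ck_on :: "nat \<Rightarrow> 'a::euclidean_space set \<Rightarrow> ('a \<Rightarrow> 'b::euclidean_space) \<Rightarrow> bool" where
  "Ck_on 0 S f \<longleftrightarrow> continuous_on S f"
| "Ck_on (Suc k) S f \<longleftrightarrow>
     (\<forall>x\<in>S. f differentiable (at x)) \<and> (\<forall>v. Ck_on k S (\<lambda>x. frechet_derivative f (at x) v))"

definition smooth_on :: "'a::euclidean_space set \<Rightarrow> ('a \<Rightarrow> 'b::euclidean_space) \<Rightarrow> bool" where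
  "smooth_on S f \<longleftrightarrow> (\<forall>k. Ck_on k S f)"

text \<open>A chart is a pair (domain, coordinate map); the values of the coordinate map outside the
  domain are irrelevant. The manifold is always the whole (Hausdorff, second countable) type.\<close>

type_synonym ('m, 'a) chart = "'m set \<times> ('m \<Rightarrow> 'a)"

definition chart_inv :: "('m, 'a) chart \<Rightarrow> 'a \<Rightarrow> 'm" where
  "chart_inv c = inv_into (fst c) (snd c)"

definition smooth_atlas :: "('m::{t2_space,second_countable_topology}, 'a::euclidean_space) chart set \<Rightarrow> bool" where
  "smooth_atlas A \<longleftrightarrow>
     (\<forall>c\<in>A. open (fst c) \<and> open (snd c ` fst c) \<and>
        homeomorphism (fst c) (snd c ` fst c) (snd c) (chart_inv c)) \<and>
     (\<Union>c\<in>A. fst c) = UNIV \<and>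
     (\<forall>c\<in>A. \<forall>d\<in>A. smooth_on (snd c ` (fst c \<inter> fst d)) (snd d \<circ> chart_inv c))"

text \<open>A tangent vector at x is the family of its components in all charts around x, subject to the
  usual transformation law (and set to 0 on the irrelevant charts, so that equality of tangent
  vectors is equality of functions). Linear combinations are taken chart by chart.\<close>

type_synonym ('m, 'a) tvec = "('m, 'a) chart \<Rightarrow> 'a"

definition tangent_space :: "('m, 'a::euclidean_space) chart set \<Rightarrow> 'm \<Rightarrow> ('m, 'a) tvec set" where
  "tangent_space A x =
     {v. (\<forall>c. \<not> (c \<in> A \<and> x \<in> fst c) \<longrightarrow> v c = 0) \<and>
         (\<forall>c\<in>A. \<forall>d\<in>A. x \<in> fst c \<inter> fst d \<longrightarrow>
            v d = frechet_derivative (snd d \<circ> chart_inv c) (at (snd c x)) (v c))}"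

definition coord_vec :: "('m, 'a::euclidean_space) chart set \<Rightarrow> ('m, 'a) chart \<Rightarrow> 'm \<Rightarrow> 'a \<Rightarrow> ('m, 'a) tvec" where
  \<comment> \<open>the tangent vector at x whose component in the chart c is a\<close>
  "coord_vec A c x a =
     (\<lambda>d. if d \<in> A \<and> x \<in> fst d then frechet_derivative (snd d \<circ> chart_inv c) (at (snd c x)) a else 0)"

definition chart_at :: "('m, 'a) chart set \<Rightarrow> 'm \<Rightarrow> ('m, 'a) chart" where
  \<comment> \<open>auxiliary choice; everything defined below through it is chart independent\<close>
  "chart_at A x = (SOME c. c \<in> A \<and> x \<in> fst c)"

definition smooth_map :: "('m::topological_space, 'a::euclidean_space) chart set \<Rightarrow>
    ('k::topological_space, 'b::euclidean_space) chart set \<Rightarrow> ('m \<Rightarrow> 'k) \<Rightarrow> bool" where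
  "smooth_map A B f \<longleftrightarrow> continuous_on UNIV f \<and>
     (\<forall>c\<in>A. \<forall>d\<in>B. smooth_on (snd c ` (fst c \<inter> f -` fst d)) (snd d \<circ> f \<circ> chart_inv c))"

definition tmap :: "('m, 'a::euclidean_space) chart set \<Rightarrow> ('k, 'b::euclidean_space) chart set \<Rightarrow>
    ('m \<Rightarrow> 'k) \<Rightarrow> 'm \<Rightarrow> ('m, 'a) tvec \<Rightarrow> ('k, 'b) tvec" where
  \<comment> \<open>the differential of f at x\<close>
  "tmap A B f x v =
     (\<lambda>d. if d \<in> B \<and> f x \<in> fst d
          then frechet_derivative (snd d \<circ> f \<circ> chart_inv (chart_at A x))
                 (at (snd (chart_at A x) x)) (v (chart_at A x))
          else 0)"

definition prod_atlas :: "('m, 'a) chart set \<Rightarrow> ('k, 'b) chart set \<Rightarrow> ('m \<times> 'k, 'a \<times> 'b) chart set" where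
  "prod_atlas A B = {(fst c \<times> fst d, map_prod (snd c) (snd d)) | c d. c \<in> A \<and> d \<in> B}"

definition line_atlas :: "(real, real) chart set" where
  "line_atlas = {(UNIV, id)}"

definition vf_bracket :: "('m, 'a::euclidean_space) chart set \<Rightarrow> ('m \<Rightarrow> ('m, 'a) tvec) \<Rightarrow>
    ('m \<Rightarrow> ('m, 'a) tvec) \<Rightarrow> 'm \<Rightarrow> ('m, 'a) tvec" where
  \<comment> \<open>Lie bracket of vector fields: the component of [X,Y] in a chart is DY.X - DX.Y\<close>
  "vf_bracket A X Y x =
     (\<lambda>d. if d \<in> A \<and> x \<in> fst d
          then frechet_derivative (\<lambda>y. Y (chart_inv d y) d) (at (snd d x)) (X x d)
             - frechet_derivative (\<lambda>y. X (chart_inv d y) d) (at (snd d x)) (Y x d)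
          else 0)"


section \<open>G-structures\<close>

text \<open>A frame at x is a linear isomorphism from the model space onto the tangent space at x;
  a point of the linear frame bundle is a pair (x, frame at x).\<close>

type_synonym ('m, 'a) frame = "'a \<Rightarrow> ('m, 'a) tvec"

definition is_frame :: "('m, 'a::euclidean_space) chart set \<Rightarrow> 'm \<Rightarrow> ('m, 'a) frame \<Rightarrow> bool" where
  "is_frame A x u \<longleftrightarrow> (\<forall>c. linear (\<lambda>w. u w c)) \<and> bij_betw u UNIV (tangent_space A x)"

definition frame_bundle :: "('m, 'a::euclidean_space) chart set \<Rightarrow> ('m \<times> ('m, 'a) frame) set" where
  "frame_bundle A = {(x, u). is_frame A x u}"

definition smooth_section :: "('m, real^'n) chart set \<Rightarrow> ('m \<times> ('m, real^'n) frame) set \<Rightarrow>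
    'm set \<Rightarrow> ('m \<Rightarrow> ('m, real^'n) frame) \<Rightarrow> bool" where
  "smooth_section A P U s \<longleftrightarrow> (\<forall>x\<in>U. (x, s x) \<in> P) \<and>
     (\<forall>c\<in>A. \<forall>w. smooth_on (snd c ` (U \<inter> fst c)) (\<lambda>y. s (chart_inv c y) w c))"

definition closed_GL_subgroup :: "(real^'n^'n) set \<Rightarrow> bool" where
  "closed_GL_subgroup G \<longleftrightarrow> mat 1 \<in> G \<and> (\<forall>a\<in>G. \<forall>b\<in>G. a ** b \<in> G) \<and>
     (\<forall>a\<in>G. invertible a \<and> matrix_inv a \<in> G) \<and> closedin (top_of_set {a. invertible a}) G"

text \<open>A reduction of the frame bundle to the closed subgroup G: a set P of frames, whose intersection
  with each fibre is an orbit of the right action u.g = u o g of G, and which has local smooth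
  sections.\<close>

definition G_structure :: "('m::{t2_space,second_countable_topology}, real^'n) chart set \<Rightarrow>
    (real^'n^'n) set \<Rightarrow> ('m \<times> ('m, real^'n) frame) set \<Rightarrow> bool" where
  "G_structure A G P \<longleftrightarrow> closed_GL_subgroup G \<and> P \<subseteq> frame_bundle A \<and>
     (\<forall>x u g. (x, u) \<in> P \<and> invertible g \<longrightarrow> ((x, \<lambda>w. u (g *v w)) \<in> P \<longleftrightarrow> g \<in> G)) \<and>
     (\<forall>x. \<exists>U s. open U \<and> x \<in> U \<and> smooth_section A P U s)"

text \<open>Value of the soldering form at the frame u on a vector projecting onto the tangent vector X.\<close>

definition solder :: "('m, 'a) frame \<Rightarrow> ('m, 'a) tvec \<Rightarrow> 'a" where
  "solder u X = (THE w. u w = X)"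


section \<open>Lie groups and flat k-reductive homogeneous structures\<close>

definition lie_group :: "'h monoid \<Rightarrow> ('h::{t2_space,second_countable_topology}, 'e::euclidean_space) chart set \<Rightarrow> bool" where
  "lie_group H A \<longleftrightarrow> group H \<and> carrier H = UNIV \<and> smooth_atlas A \<and>
     smooth_map (prod_atlas A A) A (\<lambda>(a, b). a \<otimes>\<^bsub>H\<^esub> b) \<and>
     smooth_map A A (\<lambda>a. inv\<^bsub>H\<^esub> a)"

definition lie_algebra :: "('e::euclidean_space \<Rightarrow> 'e \<Rightarrow> 'e) \<Rightarrow> bool" where
  "lie_algebra br \<longleftrightarrow> bilinear br \<and> (\<forall>X. br X X = 0) \<and>
     (\<forall>X Y Z. br X (br Y Z) + br Y (br Z X) + br Z (br X Y) = 0)"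

definition left_invariant_field :: "'h monoid \<Rightarrow> ('h, 'e::euclidean_space) chart set \<Rightarrow>
    ('h, 'e) tvec \<Rightarrow> 'h \<Rightarrow> ('h, 'e) tvec" where
  "left_invariant_field H A X a = tmap A A (\<lambda>b. a \<otimes>\<^bsub>H\<^esub> b) \<one>\<^bsub>H\<^esub> X"

text \<open>The Lie algebra of H is presented as a bracket on the model space together with a Lie algebra
  isomorphism \<epsilon> onto the tangent space at the identity, whose bracket is
  that of left invariant vector fields.\<close>

definition is_lie_algebra_of :: "'h monoid \<Rightarrow> ('h, 'e::euclidean_space) chart set \<Rightarrow>
    ('e \<Rightarrow> 'e \<Rightarrow> 'e) \<Rightarrow> ('h, 'e) frame \<Rightarrow> bool" where
  "is_lie_algebra_of H A br \<epsilon> \<longleftrightarrow> lie_algebra br \<and> is_frame A \<one>\<^bsub>H\<^esub> \<epsilon> \<and>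
     (\<forall>X Y. \<epsilon> (br X Y) =
        vf_bracket A (left_invariant_field H A (\<epsilon> X)) (left_invariant_field H A (\<epsilon> Y)) \<one>\<^bsub>H\<^esub>)"

text \<open>Lie algebra of a closed subgroup: velocities at 0 of the one-parameter subgroups lying in it.\<close>

definition lie_subalgebra_of :: "'h::topological_space monoid \<Rightarrow> ('h, 'e::euclidean_space) chart set \<Rightarrow>
    ('h, 'e) frame \<Rightarrow> 'h set \<Rightarrow> 'e set" where
  "lie_subalgebra_of H A \<epsilon> K =
     {X. \<exists>\<gamma>::real \<Rightarrow> 'h. smooth_map line_atlas A \<gamma> \<and> (\<forall>s t. \<gamma> (s + t) = \<gamma> s \<otimes>\<^bsub>H\<^esub> \<gamma> t) \<and>
        range \<gamma> \<subseteq> K \<and> tmap line_atlas A \<gamma> 0 (coord_vec line_atlas (UNIV, id) 0 1) = \<epsilon> X}"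

definition graded_lie_algebra :: "('e::euclidean_space \<Rightarrow> 'e \<Rightarrow> 'e) \<Rightarrow> (int \<Rightarrow> 'e set) \<Rightarrow> nat \<Rightarrow> bool" where
  "graded_lie_algebra br h k \<longleftrightarrow> lie_algebra br \<and> (\<forall>p. subspace (h p)) \<and>
     (\<forall>p. p \<notin> {-1..int k - 1} \<longrightarrow> h p = {0}) \<and>
     (\<forall>X. \<exists>!f. (\<forall>p. f p \<in> h p) \<and> X = (\<Sum>p\<in>{-1..int k - 1}. f p)) \<and>
     (\<forall>r s. \<forall>X\<in>h r. \<forall>Y\<in>h s. br X Y \<in> h (r + s))"

text \<open>Image of the isotropy representation at x0, written as matrices through the frame u0,
  and the orbit of the frame u0.\<close>

definition isotropy_matrices :: "('mt, real^'N) chart set \<Rightarrow> ('h \<Rightarrow> 'mt \<Rightarrow> 'mt) \<Rightarrow> 'h set \<Rightarrow>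
    'mt \<Rightarrow> ('mt, real^'N) frame \<Rightarrow> (real^'N^'N) set" where
  "isotropy_matrices A act K x0 u0 =
     {g. \<exists>a\<in>K. \<forall>v. tmap A A (act a) x0 (u0 v) = u0 (g *v v)}"

definition orbit_structure :: "('mt, real^'N) chart set \<Rightarrow> 'h monoid \<Rightarrow> ('h \<Rightarrow> 'mt \<Rightarrow> 'mt) \<Rightarrow>
    'mt \<Rightarrow> ('mt, real^'N) frame \<Rightarrow> ('mt \<times> ('mt, real^'N) frame) set" where
  "orbit_structure A H act x0 u0 = {(act a x0, \<lambda>v. tmap A A (act a) x0 (u0 v)) | a. a \<in> carrier H}"

text \<open>The homogeneous manifold H/K is presented as a manifold with a smooth transitive action of H
  and K the stabilizer of the base point x0. The map \<theta> is the identification of the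
  model space V with the degree -1 part of the Lie algebra which is induced by
  u0 and by the differential of the orbit map a -> a.x0, whose kernel is Lie(K).\<close>

locale flat_k_reductive =
  fixes H :: "'h::{t2_space,second_countable_topology} monoid"
    and AH :: "('h, 'e::euclidean_space) chart set"
    and K :: "'h set"
    and AMt :: "('mt::{t2_space,second_countable_topology}, real^'N) chart set"
    and act :: "'h \<Rightarrow> 'mt \<Rightarrow> 'mt"
    and x0 :: 'mt
    and u0 :: "('mt, real^'N) frame"
    and Gt :: "(real^'N^'N) set"
    and Pt :: "('mt \<times> ('mt, real^'N) frame) set"
    and br :: "'e \<Rightarrow> 'e \<Rightarrow> 'e"
    and \<epsilon> :: "('h, 'e) frame"
    and k :: nat
    and h :: "int \<Rightarrow> 'e set"
    and \<theta> :: "real^'N \<Rightarrow> 'e"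
  assumes lie_group: "lie_group H AH"
    and connected_H: "connected (UNIV :: 'h set)"
    and simply_connected_H: "simply_connected (UNIV :: 'h set)"
    and atlas: "smooth_atlas AMt"
    and transitive: "transitive_action H UNIV act"
    and effective: "faithful_action H UNIV act"
    and smooth_action: "smooth_map (prod_atlas AH AMt) AMt (\<lambda>(a, x). act a x)"
    and stabilizer: "K = stabilizer H act x0"
    and connected_K: "connected K"
    and frame: "is_frame AMt x0 u0"
    and isotropy: "Gt = isotropy_matrices AMt act K x0 u0"
    and orbit_struct: "Pt = orbit_structure AMt H act x0 u0"
    and Gt_structure: "G_structure AMt Gt Pt"
    and lie_algebra_H: "is_lie_algebra_of H AH br \<epsilon>"
    and graded: "graded_lie_algebra br h k"
    and lie_algebra_K: "lie_subalgebra_of H AH \<epsilon> K =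
          {X. \<exists>f. (\<forall>p. f p \<in> h p) \<and> X = (\<Sum>p\<in>{0..int k - 1}. f p)}"
    and identification: "linear \<theta>" "bij_betw \<theta> UNIV (h (-1))"
      "\<forall>v. tmap AH AMt (\<lambda>a. act a x0) \<one>\<^bsub>H\<^esub> (\<epsilon> (\<theta> v)) = u0 v"


section \<open>The subspace W and the group of upper left blocks\<close>

text \<open>Finite index types carry no preferred order, so the "first n coordinates" are those whose
  index lies in the range of an injection j :: 'n \<Rightarrow> 'N. The map \<open>W_incl j\<close> identifies
  the space with coordinates in 'n with the subspace W of V.\<close>

definition W_incl :: "('n \<Rightarrow> 'N) \<Rightarrow> real^'n \<Rightarrow> real^'N" where
  "W_incl j w = (\<chi> a. if a \<in> range j then w $ (inv_into UNIV j a) else 0)"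

definition G_sharp :: "('n \<Rightarrow> 'N) \<Rightarrow> (real^'N^'N) set \<Rightarrow> (real^'N^'N) set" where
  "G_sharp j Gt = {g \<in> Gt. \<forall>a b. a \<notin> range j \<and> b \<in> range j \<longrightarrow> g $ a $ b = 0}"

definition upper_left_blocks :: "('n \<Rightarrow> 'N) \<Rightarrow> (real^'N^'N) set \<Rightarrow> (real^'n^'n) set" where
  "upper_left_blocks j S = (\<lambda>g. \<chi> a b. g $ (j a) $ (j b)) ` S"


section \<open>Forms and admissible tuples\<close>

type_synonym ('m, 'a, 'e) form1 = "'m \<Rightarrow> ('m, 'a) tvec \<Rightarrow> 'e"
type_synonym ('m, 'a, 'e) form2 = "'m \<Rightarrow> ('m, 'a) tvec \<Rightarrow> ('m, 'a) tvec \<Rightarrow> 'e"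

definition smooth_form1 :: "('m, 'a::euclidean_space) chart set \<Rightarrow> 'm set \<Rightarrow> 'e::euclidean_space set \<Rightarrow>
    ('m, 'a, 'e) form1 \<Rightarrow> bool" where
  \<comment> \<open>smooth 1-form on U with values in the subspace E\<close>
  "smooth_form1 A U E \<alpha> \<longleftrightarrow>
     (\<forall>x\<in>U. \<forall>X\<in>tangent_space A x. \<alpha> x X \<in> E) \<and>
     (\<forall>x\<in>U. \<forall>X\<in>tangent_space A x. \<forall>Y\<in>tangent_space A x. \<forall>a b.
        \<alpha> x (\<lambda>c. a *\<^sub>R X c + b *\<^sub>R Y c) = a *\<^sub>R \<alpha> x X + b *\<^sub>R \<alpha> x Y) \<and>
     (\<forall>c\<in>A. \<forall>v. smooth_on (snd c ` (U \<inter> fst c))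
        (\<lambda>y. \<alpha> (chart_inv c y) (coord_vec A c (chart_inv c y) v)))"

text \<open>Exterior derivative, with the convention d\<alpha>(X,Y) = X(\<alpha>(Y)) - Y(\<alpha>(X)) - \<alpha>([X,Y]),
  evaluated on coordinate fields with constant components in a chart.\<close>

definition ext_deriv :: "('m, 'a::euclidean_space) chart set \<Rightarrow> ('m, 'a, 'e::euclidean_space) form1 \<Rightarrow>
    ('m, 'a, 'e) form2" where
  "ext_deriv A \<alpha> x X Y =
     (let c = chart_at A x;
          loc = (\<lambda>v y. \<alpha> (chart_inv c y) (coord_vec A c (chart_inv c y) v))
      in frechet_derivative (loc (Y c)) (at (snd c x)) (X c)
       - frechet_derivative (loc (X c)) (at (snd c x)) (Y c))"

definition bracket_form :: "('e \<Rightarrow> 'e \<Rightarrow> 'e::euclidean_space) \<Rightarrow> ('m, 'a, 'e) form1 \<Rightarrow> ('m, 'a, 'e) form1 \<Rightarrow>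
    ('m, 'a, 'e) form2" where
  "bracket_form br \<alpha> \<beta> x X Y = br (\<alpha> x X) (\<beta> x Y) - br (\<alpha> x Y) (\<beta> x X)"

text \<open>\<open>full_tuple e s \<omega>\<close> extends the forms \<omega>^r, r \<ge> 0, by \<omega>^{-1}: the pull back of the soldering form by s,
  viewed in degree -1 through the map e (the inclusion of W in V followed by the
  identification of V with the degree -1 part). Since s is a section, s_* X projects onto X, so that the
  pull back of the soldering form is X \<mapsto> solder (s x) X.\<close>

definition full_tuple :: "(real^'n \<Rightarrow> 'e) \<Rightarrow> ('m \<Rightarrow> ('m, real^'n) frame) \<Rightarrow>
    (int \<Rightarrow> ('m, real^'n, 'e) form1) \<Rightarrow> int \<Rightarrow> ('m, real^'n, 'e) form1" where
  "full_tuple e s \<omega> r = (if r = -1 then (\<lambda>x X. e (solder (s x) X)) else \<omega> r)"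

text \<open>\<open>total_curvature \<dots> q\<close> is d\<omega>^q + 1/2 \<Sum>_{r=0}^q [\<omega>^r, \<omega>^(q-r)]; the sum is empty for q = -1.\<close>

definition total_curvature :: "('m, real^'n) chart set \<Rightarrow> ('e::euclidean_space \<Rightarrow> 'e \<Rightarrow> 'e) \<Rightarrow>
    (real^'n \<Rightarrow> 'e) \<Rightarrow> ('m \<Rightarrow> ('m, real^'n) frame) \<Rightarrow> (int \<Rightarrow> ('m, real^'n, 'e) form1) \<Rightarrow> int \<Rightarrow>
    ('m, real^'n, 'e) form2" where
  "total_curvature A br e s \<omega> q x X Y =
     ext_deriv A (full_tuple e s \<omega> q) x X Y +
     (1/2) *\<^sub>R (\<Sum>r\<in>{0..q}. bracket_form br (full_tuple e s \<omega> r) (full_tuple e s \<omega> (q - r)) x X Y)"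

text \<open>Only the components \<omega>^0, ..., \<omega>^{p-1} of \<omega> are relevant.\<close>

definition admissible :: "('m::topological_space, real^'n) chart set \<Rightarrow> ('m \<times> ('m, real^'n) frame) set \<Rightarrow>
    ('e::euclidean_space \<Rightarrow> 'e \<Rightarrow> 'e) \<Rightarrow> (int \<Rightarrow> 'e set) \<Rightarrow> (real^'n \<Rightarrow> 'e) \<Rightarrow> nat \<Rightarrow>
    'm set \<Rightarrow> ('m \<Rightarrow> ('m, real^'n) frame) \<Rightarrow> (int \<Rightarrow> ('m, real^'n, 'e) form1) \<Rightarrow> bool" where
  "admissible A P br h e p U s \<omega> \<longleftrightarrow> open U \<and> smooth_section A P U s \<and>
     (\<forall>r\<in>{0..int p - 1}. smooth_form1 A U (h r) (\<omega> r)) \<and>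
     (\<forall>q\<in>{0..int p - 1}. \<forall>x\<in>U. \<forall>X\<in>tangent_space A x. \<forall>Y\<in>tangent_space A x.
        total_curvature A br e s \<omega> (q - 1) x X Y =
        - bracket_form br (full_tuple e s \<omega> (-1)) (\<omega> q) x X Y)"

definition locally_immersible :: "('m::topological_space, real^'n) chart set \<Rightarrow> ('m \<times> ('m, real^'n) frame) set \<Rightarrow>
    ('e::euclidean_space \<Rightarrow> 'e \<Rightarrow> 'e) \<Rightarrow> (int \<Rightarrow> 'e set) \<Rightarrow> (real^'n \<Rightarrow> 'e) \<Rightarrow> nat \<Rightarrow> bool" where
  "locally_immersible A P br h e p \<longleftrightarrow> (\<forall>x. \<exists>U s \<omega>. x \<in> U \<and> admissible A P br h e p U s \<omega>)"


section \<open>Cochains with values in the quotients by the annihilators\<close>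

text \<open>\<open>annihilator br h e j r\<close> is c^j_r for j \<ge> 0. For j < 0 it is {0}, so that the
  projection modulo it is the identity (up to the identification X = {X}).\<close>

definition annihilator :: "('e::euclidean_space \<Rightarrow> 'e \<Rightarrow> 'e) \<Rightarrow> (int \<Rightarrow> 'e set) \<Rightarrow> (real^'n \<Rightarrow> 'e) \<Rightarrow>
    int \<Rightarrow> nat \<Rightarrow> 'e set" where
  "annihilator br h e j r =
     (if j < 0 then {0}
      else if int r \<le> j + 1
      then {X \<in> h j. \<forall>ws. length ws = r \<longrightarrow> foldl (\<lambda>Y w. br Y (e w)) X ws = 0}
      else h j)"

text \<open>An element of h^j / c^j_r is a coset \<open>X +o annihilator br h e j r\<close>. Cosets are added by the set
  addition; multiplying by a scalar requires adding the annihilator again (for the scalar 0).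
  An element of C^{p,q}_r = (h^{p-1} / c^{p-1}_r) \<otimes> \<Lambda>^q W^* is an alternating
  multilinear map on lists of q elements of W, where W is parametrized by its n coordinates. For
  p < 0 this gives the zero space.\<close>

definition cochains :: "('e::euclidean_space \<Rightarrow> 'e \<Rightarrow> 'e) \<Rightarrow> (int \<Rightarrow> 'e set) \<Rightarrow> (real^'n \<Rightarrow> 'e) \<Rightarrow>
    int \<Rightarrow> nat \<Rightarrow> nat \<Rightarrow> ((real^'n) list \<Rightarrow> 'e set) set" where
  "cochains br h e p q r =
     (let N = annihilator br h e (p - 1) r in
      {c \<in> {ws. length ws = q} \<rightarrow>\<^sub>E {X +o N | X. X \<in> h (p - 1)}.
        (\<forall>ws i a b v w. length ws = q \<and> i < q \<longrightarrow>
           c (ws[i := a *\<^sub>R v + b *\<^sub>R w]) =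
             ((\<lambda>X. a *\<^sub>R X) ` c (ws[i := v]) + N) + ((\<lambda>X. b *\<^sub>R X) ` c (ws[i := w]) + N)) \<and>
        (\<forall>ws i l. length ws = q \<and> i < l \<and> l < q \<and> ws ! i = ws ! l \<longrightarrow> c ws = N)})"

definition zero_cochain :: "('e::euclidean_space \<Rightarrow> 'e \<Rightarrow> 'e) \<Rightarrow> (int \<Rightarrow> 'e set) \<Rightarrow> (real^'n \<Rightarrow> 'e) \<Rightarrow>
    int \<Rightarrow> nat \<Rightarrow> nat \<Rightarrow> (real^'n) list \<Rightarrow> 'e set" where
  "zero_cochain br h e p q r = (\<lambda>ws\<in>{ws. length ws = q}. annihilator br h e (p - 1) r)"

text \<open>The operator from C^{p,q}_r to C^{p-1,q+1}_r. List positions start at 0, whence the sign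
  (-1)^(i+1). On C^{0,q}_r it vanishes, as the brackets then lie in h^{-2} = {0}.\<close>

definition cobdry :: "('e::euclidean_space \<Rightarrow> 'e \<Rightarrow> 'e) \<Rightarrow> (int \<Rightarrow> 'e set) \<Rightarrow> (real^'n \<Rightarrow> 'e) \<Rightarrow>
    int \<Rightarrow> nat \<Rightarrow> nat \<Rightarrow> ((real^'n) list \<Rightarrow> 'e set) \<Rightarrow> (real^'n) list \<Rightarrow> 'e set" where
  "cobdry br h e p q r c =
     (\<lambda>ws\<in>{ws. length ws = q + 1}. \<Sum>i\<in>{0..q}.
        (\<lambda>X. (-1) ^ (i + 1) *\<^sub>R br X (e (ws ! i))) ` c (take i ws @ drop (Suc i) ws)
        + annihilator br h e (p - 2) r)"

definition cocycles :: "('e::euclidean_space \<Rightarrow> 'e \<Rightarrow> 'e) \<Rightarrow> (int \<Rightarrow> 'e set) \<Rightarrow> (real^'n \<Rightarrow> 'e) \<Rightarrow>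
    int \<Rightarrow> nat \<Rightarrow> nat \<Rightarrow> ((real^'n) list \<Rightarrow> 'e set) set" where
  "cocycles br h e p q r =
     {c \<in> cochains br h e p q r. cobdry br h e p q r c = zero_cochain br h e (p - 1) (q + 1) r}"

definition coboundaries :: "('e::euclidean_space \<Rightarrow> 'e \<Rightarrow> 'e) \<Rightarrow> (int \<Rightarrow> 'e set) \<Rightarrow> (real^'n \<Rightarrow> 'e) \<Rightarrow>
    int \<Rightarrow> nat \<Rightarrow> nat \<Rightarrow> ((real^'n) list \<Rightarrow> 'e set) set" where
  "coboundaries br h e p q r =
     (if q = 0 then {zero_cochain br h e p q r}
      else cobdry br h e (p + 1) (q - 1) r ` cochains br h e (p + 1) (q - 1) r)"

definition cocycle_group :: "('e::euclidean_space \<Rightarrow> 'e \<Rightarrow> 'e) \<Rightarrow> (int \<Rightarrow> 'e set) \<Rightarrow> (real^'n \<Rightarrow> 'e) \<Rightarrow>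
    int \<Rightarrow> nat \<Rightarrow> nat \<Rightarrow> ((real^'n) list \<Rightarrow> 'e set) monoid" where
  "cocycle_group br h e p q r =
     \<lparr>carrier = cocycles br h e p q r,
      mult = (\<lambda>c d. \<lambda>ws\<in>{ws. length ws = q}. c ws + d ws),
      one = zero_cochain br h e p q r\<rparr>"

definition cohomology_group :: "('e::euclidean_space \<Rightarrow> 'e \<Rightarrow> 'e) \<Rightarrow> (int \<Rightarrow> 'e set) \<Rightarrow> (real^'n \<Rightarrow> 'e) \<Rightarrow>
    int \<Rightarrow> nat \<Rightarrow> nat \<Rightarrow> ((real^'n) list \<Rightarrow> 'e set) set monoid" where
  "cohomology_group br h e p q r = cocycle_group br h e p q r Mod coboundaries br h e p q r"

definition cohomology_class :: "('e::euclidean_space \<Rightarrow> 'e \<Rightarrow> 'e) \<Rightarrow> (int \<Rightarrow> 'e set) \<Rightarrow> (real^'n \<Rightarrow> 'e) \<Rightarrow>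
    int \<Rightarrow> nat \<Rightarrow> nat \<Rightarrow> ((real^'n) list \<Rightarrow> 'e set) \<Rightarrow> ((real^'n) list \<Rightarrow> 'e set) set" where
  "cohomology_class br h e p q r c = coboundaries br h e p q r #>\<^bsub>cocycle_group br h e p q r\<^esub> c"

text \<open>The curvature \<Omega>^{p-1} of level r at x, as an element of C^{p,2}_r via the frame s x.
  For r = 0 the annihilator is {0}, and this is \<Omega>^{p-1} at x itself.\<close>

definition curvature_cochain :: "('m, real^'n) chart set \<Rightarrow> ('e::euclidean_space \<Rightarrow> 'e \<Rightarrow> 'e) \<Rightarrow>
    (int \<Rightarrow> 'e set) \<Rightarrow> (real^'n \<Rightarrow> 'e) \<Rightarrow> ('m \<Rightarrow> ('m, real^'n) frame) \<Rightarrow>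
    (int \<Rightarrow> ('m, real^'n, 'e) form1) \<Rightarrow> int \<Rightarrow> nat \<Rightarrow> 'm \<Rightarrow> (real^'n) list \<Rightarrow> 'e set" where
  "curvature_cochain A br h e s \<omega> p r x =
     (\<lambda>ws\<in>{ws. length ws = 2}.
        total_curvature A br e s \<omega> (p - 1) x (s x (ws ! 0)) (s x (ws ! 1))
        +o annihilator br h e (p - 1) r)"

end

theory Submission
  imports Defs
begin

text \<open>Write \<open>\<omega>\<close> for the sum of \<open>\<omega>\<^sup>-\<^sup>1, \<dots>, \<omega>\<^sup>p\<^sup>-\<^sup>1\<close> and \<open>F = d\<omega> + 1/2 [\<omega>, \<omega>]\<close>. Admissibility says that the components
  of \<open>F\<close> of degree less than \<open>p - 1\<close> vanish, and its component of degree \<open>p - 1\<close> is \<open>\<Omega>\<^sup>p\<^sup>-\<^sup>1\<close>. In degree \<open>p - 2\<close> the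
  Bianchi identity \<open>dF = [F, \<omega>]\<close> therefore reads \<open>[\<Omega>\<^sup>p\<^sup>-\<^sup>1, \<omega>\<^sup>-\<^sup>1] = 0\<close>, which is the cocycle condition.
  The equation to be solved for \<open>\<omega>\<^sup>p\<close> is \<open>\<Omega>\<^sup>p\<^sup>-\<^sup>1 = \<partial>(-\<omega>\<^sup>p)\<close> at each point; a fixed linear right inverse of
  the coboundary operator, applied in the frames \<open>s\<^sub>x\<close>, gives a solution depending smoothly on the point.\<close>

section \<open>Calculus of smooth maps\<close>

text \<open>No forms of degree \<open>p\<close> or more are available, so the components of F in
  these degrees carry no information. The Bianchi identity is therefore read modulo elements of high
  degree. This is possible because differentiation preserves a subspace of values and because a
  bracket with a form of degree at least -1 lowers degrees by at most one. Since
  \<open>ext_deriv\<close> uses a chart selected separately at each point, its independence of the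
  chart must be known before curvatures can be differentiated. Both this and the Bianchi identity
  rest on the symmetry of second derivatives. The levels r >= 1 need no new geometry: for r <= p the
  bracket with W passes to the quotients by the annihilators, so one bracket identity yields the
  cocycle condition at every level. In (ii), vanishing of the class gives some primitive at each
  point, with no control over how it varies. In the frames s_x, however, the coboundary operator has
  constant coefficients, which is why one linear right inverse serves all points.\<close>

lemma Ck_on_cong:
  assumes "open S" "Ck_on k S f" "\<And>x. x \<in> S \<Longrightarrow> f x = g x"
  shows "Ck_on k S g"
  using assms(2,3)
proof (induction k arbitrary: f g)
  case 0
  then show ?case using continuous_on_cong by force
next
  case (Suc k)
  \<comment> \<open>Openness matters here: the derivative is taken in the full space, so f and g
    must agree on a whole neighbourhood of x.\<close>
  have fg: "(g has_derivative frechet_derivative f (at x)) (at x)" if "x \<in> S" for x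
    using Suc.prems that assms(1)
    by (auto intro!: has_derivative_transform_within_open[of f _ x UNIV S g] simp: frechet_derivative_works)
  then have "frechet_derivative f (at x) = frechet_derivative g (at x)" if "x \<in> S" for x
    using frechet_derivative_at that by blast
  then have "Ck_on k S (\<lambda>x. frechet_derivative g (at x) v)" for v
    using Suc.IH[of "\<lambda>x. frechet_derivative f (at x) v" "\<lambda>x. frechet_derivative g (at x) v"] Suc.prems(1)
    by simp
  then show ?case using fg by (auto simp: differentiable_def)
qed

text \<open>Frees the inductions below from \<open>frechet_derivative\<close>: by uniqueness of
  derivatives, any explicit formula for the derivative may be supplied.\<close>

lemma Ck_on_Suc_I:
  assumes "open S" "\<And>x. x \<in> S \<Longrightarrow> (f has_derivative f' x) (at x)"
    and "\<And>v. Ck_on k S (\<lambda>x. f' x v)"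
  shows "Ck_on (Suc k) S f"
proof -
  have "frechet_derivative f (at x) = f' x" if "x \<in> S" for x
    using assms(2)[OF that] frechet_derivative_at by metis
  then have "Ck_on k S (\<lambda>x. frechet_derivative f (at x) v)" for v
    by (intro Ck_on_cong[OF assms(1,3)]) simp
  then show ?thesis using assms(2) by (auto simp: differentiable_def)
qed

lemma Ck_on_Suc_D:
  assumes "Ck_on (Suc k) S f" "x \<in> S"
  shows "(f has_derivative frechet_derivative f (at x)) (at x)"
  using assms by (auto simp: frechet_derivative_works)

lemma Ck_on_SucD: "Ck_on (Suc k) S f \<Longrightarrow> Ck_on k S f"
proof (induction k arbitrary: f)
  case 0
  then show ?case
    by (auto intro!: continuous_at_imp_continuous_on differentiable_imp_continuous_within)
next
  case (Suc k)
  then show ?case by (auto simp del: Ck_on.simps(1))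
qed

lemma Ck_on_subset: "Ck_on k S f \<Longrightarrow> T \<subseteq> S \<Longrightarrow> Ck_on k T f"
  by (induction k arbitrary: f) (auto intro: continuous_on_subset)

lemma Ck_on_const: "Ck_on k S (\<lambda>x. c)"
  by (induction k arbitrary: c) auto

lemma Ck_on_add:
  assumes "open S" "Ck_on k S f" "Ck_on k S g"
  shows "Ck_on k S (\<lambda>x. f x + g x)"
  using assms(2,3)
proof (induction k arbitrary: f g)
  case 0
  then show ?case by (auto intro: continuous_intros)
next
  case (Suc k)
  show ?case
  proof (rule Ck_on_Suc_I[OF assms(1)])
    show "((\<lambda>x. f x + g x) has_derivative
        (\<lambda>v. frechet_derivative f (at x) v + frechet_derivative g (at x) v)) (at x)" if "x \<in> S" for x
      using Suc.prems that by (intro has_derivative_add) (auto intro: Ck_on_Suc_D)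
  qed (use Suc in auto)
qed

text \<open>The product rule produces the pairs (f, Dg) and (Df, g), so both functions are
  generalized in the induction, and the undifferentiated factor is lowered from class k + 1 to class
  k.\<close>

lemma Ck_on_bilinear:
  assumes B: "bounded_bilinear B" and "open S" "Ck_on k S f" "Ck_on k S g"
  shows "Ck_on k S (\<lambda>x. B (f x) (g x))"
  using assms(3,4)
proof (induction k arbitrary: f g)
  case 0
  then show ?case by (auto intro: bounded_bilinear.continuous_on[OF B])
next
  case (Suc k)
  show ?case
  proof (rule Ck_on_Suc_I[OF assms(2)])
    show "((\<lambda>x. B (f x) (g x)) has_derivative
        (\<lambda>v. B (f x) (frechet_derivative g (at x) v) + B (frechet_derivative f (at x) v) (g x))) (at x)"
      if "x \<in> S" for x
      using Suc.prems that by (intro bounded_bilinear.FDERIV[OF B]) (auto intro: Ck_on_Suc_D)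
    show "Ck_on k S (\<lambda>x. B (f x) (frechet_derivative g (at x) v)
        + B (frechet_derivative f (at x) v) (g x))" for v
      using Suc.prems Ck_on_SucD[OF Suc.prems(1)] Ck_on_SucD[OF Suc.prems(2)]
      by (intro Ck_on_add assms Suc.IH) auto
  qed
qed

lemma Ck_on_linear:
  assumes L: "linear L" and "open S" "Ck_on k S f"
  shows "Ck_on k S (\<lambda>x. L (f x))"
  using assms(3)
proof (induction k arbitrary: f)
  case 0
  then show ?case using L by (auto intro: linear_continuous_on_compose)
next
  case (Suc k)
  have "bounded_linear L" using L linear_conv_bounded_linear by blast
  then have "((\<lambda>x. L (f x)) has_derivative (\<lambda>v. L (frechet_derivative f (at x) v))) (at x)" if "x \<in> S" for x
    using Ck_on_Suc_D[OF Suc.prems that] by (rule bounded_linear.has_derivative)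
  then show ?case by (rule Ck_on_Suc_I[OF assms(2)]) (use Suc in auto)
qed

text \<open>The derivative of 1/f is a product of Df with two copies of 1/f. With f fixed, the
  induction hypothesis says that 1/f is of class k, and the product rule does the rest.\<close>

lemma Ck_on_inverse:
  fixes f :: "'a::euclidean_space \<Rightarrow> real"
  assumes "open S" "Ck_on k S f" "\<And>x. x \<in> S \<Longrightarrow> f x \<noteq> 0"
  shows "Ck_on k S (\<lambda>x. inverse (f x))"
  using assms(2)
proof (induction k)
  case 0
  then show ?case using assms(3) by (auto intro!: continuous_intros)
next
  case (Suc k)
  show ?case
  proof (rule Ck_on_Suc_I[OF assms(1)])
    show "((\<lambda>x. inverse (f x)) has_derivative
        (\<lambda>v. - (inverse (f x) * frechet_derivative f (at x) v * inverse (f x)))) (at x)"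
      if "x \<in> S" for x
      using Suc.prems that assms(3) by (intro Deriv.has_derivative_inverse) (auto intro: Ck_on_Suc_D)
    have I: "Ck_on k S (\<lambda>x. inverse (f x))" using Suc Ck_on_SucD by blast
    have m: "linear (\<lambda>x::real. - x)" by (intro linearI) auto
    show "Ck_on k S (\<lambda>x. - (inverse (f x) * frechet_derivative f (at x) v * inverse (f x)))" for v
    proof -
      have "Ck_on k S (\<lambda>x. frechet_derivative f (at x) v)" using Suc.prems by simp
      note Ck_on_bilinear[OF bounded_bilinear_mult assms(1) I this]
      note Ck_on_bilinear[OF bounded_bilinear_mult assms(1) this I]
      from Ck_on_linear[OF m assms(1) this] show ?thesis .
    qed
  qed
qed

lemma smooth_on_cong:
  "\<lbrakk>open S; smooth_on S f; \<And>x. x \<in> S \<Longrightarrow> f x = g x\<rbrakk> \<Longrightarrow> smooth_on S g"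
  unfolding smooth_on_def using Ck_on_cong by blast

lemma smooth_on_subset: "smooth_on S f \<Longrightarrow> T \<subseteq> S \<Longrightarrow> smooth_on T f"
  unfolding smooth_on_def using Ck_on_subset by blast

lemma smooth_on_const: "smooth_on S (\<lambda>x. c)"
  unfolding smooth_on_def using Ck_on_const by blast

lemma smooth_on_add:
  "\<lbrakk>open S; smooth_on S f; smooth_on S g\<rbrakk> \<Longrightarrow> smooth_on S (\<lambda>x. f x + g x)"
  unfolding smooth_on_def using Ck_on_add by blast

lemma smooth_on_bilinear:
  "\<lbrakk>bounded_bilinear B; open S; smooth_on S f; smooth_on S g\<rbrakk> \<Longrightarrow> smooth_on S (\<lambda>x. B (f x) (g x))"
  unfolding smooth_on_def using Ck_on_bilinear by blast

lemma smooth_on_linear: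
  "\<lbrakk>linear L; open S; smooth_on S f\<rbrakk> \<Longrightarrow> smooth_on S (\<lambda>x. L (f x))"
  unfolding smooth_on_def using Ck_on_linear by blast

lemma smooth_on_diff:
  assumes "open S" "smooth_on S f" "smooth_on S g"
  shows "smooth_on S (\<lambda>x. f x - g x)"
proof -
  have "linear (\<lambda>x::'b. - x)" by (intro linearI) auto
  from smooth_on_add[OF assms(1,2) smooth_on_linear[OF this assms(1,3)]] show ?thesis by simp
qed

lemma smooth_on_mult:
  fixes f g :: "'a::euclidean_space \<Rightarrow> real"
  shows "\<lbrakk>open S; smooth_on S f; smooth_on S g\<rbrakk> \<Longrightarrow> smooth_on S (\<lambda>x. f x * g x)"
  by (rule smooth_on_bilinear[OF bounded_bilinear_mult])

lemma smooth_on_scaleR: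
  "\<lbrakk>open S; smooth_on S f; smooth_on S g\<rbrakk> \<Longrightarrow> smooth_on S (\<lambda>x. f x *\<^sub>R g x)"
  by (rule smooth_on_bilinear[OF bounded_bilinear_scaleR])

lemma smooth_on_divide:
  fixes f g :: "'a::euclidean_space \<Rightarrow> real"
  assumes "open S" "smooth_on S f" "smooth_on S g" "\<And>x. x \<in> S \<Longrightarrow> g x \<noteq> 0"
  shows "smooth_on S (\<lambda>x. f x / g x)"
proof -
  have "smooth_on S (\<lambda>x. inverse (g x))"
    using assms(3) Ck_on_inverse[of S _ g] assms(1,4) unfolding smooth_on_def by blast
  from smooth_on_mult[OF assms(1,2) this] show ?thesis by (simp add: divide_inverse)
qed

lemma smooth_on_sum:
  "\<lbrakk>open S; \<And>i. i \<in> I \<Longrightarrow> smooth_on S (f i)\<rbrakk> \<Longrightarrow> smooth_on S (\<lambda>x. \<Sum>i\<in>I. f i x)"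
  by (induction I rule: infinite_finite_induct) (auto intro: smooth_on_const smooth_on_add)

lemma smooth_on_prod:
  fixes f :: "'i \<Rightarrow> 'a::euclidean_space \<Rightarrow> real"
  shows "\<lbrakk>open S; \<And>i. i \<in> I \<Longrightarrow> smooth_on S (f i)\<rbrakk> \<Longrightarrow> smooth_on S (\<lambda>x. \<Prod>i\<in>I. f i x)"
  by (induction I rule: infinite_finite_induct) (auto intro: smooth_on_const smooth_on_mult)

lemma smooth_on_det:
  fixes M :: "'a::euclidean_space \<Rightarrow> real^'n^'n"
  assumes "open S" "\<And>i j. smooth_on S (\<lambda>x. M x $ i $ j)"
  shows "smooth_on S (\<lambda>x. det (M x))"
  unfolding det_def by (intro smooth_on_sum smooth_on_mult smooth_on_const smooth_on_prod assms)

lemma smooth_on_derivative: "smooth_on S f \<Longrightarrow> smooth_on S (\<lambda>x. frechet_derivative f (at x) v)"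
  unfolding smooth_on_def by (metis Ck_on.simps(2))

lemma smooth_on_has_derivative:
  "smooth_on S f \<Longrightarrow> x \<in> S \<Longrightarrow> (f has_derivative frechet_derivative f (at x)) (at x)"
  unfolding smooth_on_def using Ck_on_Suc_D by blast

section \<open>Symmetry of second derivatives, through mixed second differences\<close>

lemma second_difference_mvt:
  fixes f :: "'a::euclidean_space \<Rightarrow> real"
  assumes "0 < t"
    and D1: "\<And>a b. 0 \<le> a \<Longrightarrow> a \<le> t \<Longrightarrow> 0 \<le> b \<Longrightarrow> b \<le> t \<Longrightarrow>
      (f has_derivative f' (x + a *\<^sub>R u + b *\<^sub>R v)) (at (x + a *\<^sub>R u + b *\<^sub>R v))"
    and D2: "\<And>a b. 0 \<le> a \<Longrightarrow> a \<le> t \<Longrightarrow> 0 \<le> b \<Longrightarrow> b \<le> t \<Longrightarrow>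
      ((\<lambda>y. f' y u) has_derivative f'' (x + a *\<^sub>R u + b *\<^sub>R v)) (at (x + a *\<^sub>R u + b *\<^sub>R v))"
  obtains a b where "0 \<le> a" "a \<le> t" "0 \<le> b" "b \<le> t"
    "f (x + t *\<^sub>R u + t *\<^sub>R v) - f (x + t *\<^sub>R u) - f (x + t *\<^sub>R v) + f x = t * t * f'' (x + a *\<^sub>R u + b *\<^sub>R v) v"
proof -
  have l: "linear (f' (x + a *\<^sub>R u + b *\<^sub>R v))" if "0 \<le> a" "a \<le> t" "0 \<le> b" "b \<le> t" for a b
    using D1[OF that] has_derivative_linear by blast
  have l2: "linear (f'' (x + a *\<^sub>R u + b *\<^sub>R v))" if "0 \<le> a" "a \<le> t" "0 \<le> b" "b \<le> t" for a b
    using D2[OF that] has_derivative_linear by blast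
  \<comment> \<open>The mixed second difference is \<open>g t - g 0\<close>. The mean value theorem
    is applied to g, which moves along u, and then to the derivative in direction u, moving along
    v.\<close>
  define g where "g a = f (x + a *\<^sub>R u + t *\<^sub>R v) - f (x + a *\<^sub>R u)" for a
  have A: "((\<lambda>a. f (x + a *\<^sub>R u + b *\<^sub>R v)) has_derivative (\<lambda>s. f' (x + a *\<^sub>R u + b *\<^sub>R v) (s *\<^sub>R u))) (at a within {0..t})"
    if "0 \<le> a" "a \<le> t" "0 \<le> b" "b \<le> t" for a b
    by (rule has_derivative_compose[where f="\<lambda>a. x + a *\<^sub>R u + b *\<^sub>R v" and f'="\<lambda>s. s *\<^sub>R u", OF _ D1[OF that]])
      (auto intro!: derivative_eq_intros)
  have "(g has_derivative (\<lambda>s. f' (x + a *\<^sub>R u + t *\<^sub>R v) (s *\<^sub>R u) - f' (x + a *\<^sub>R u) (s *\<^sub>R u))) (at a within {0..t})"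
    if "0 \<le> a" "a \<le> t" for a
    unfolding g_def using A[of a t] A[of a 0] that assms(1)
    by (intro has_derivative_diff) auto
  from mvt_very_simple[of 0 t g, OF _ this] assms(1) obtain a where a: "0 \<le> a" "a \<le> t"
    and ga: "g t - g 0 = f' (x + a *\<^sub>R u + t *\<^sub>R v) (t *\<^sub>R u) - f' (x + a *\<^sub>R u) (t *\<^sub>R u)"
    by auto
  have B: "((\<lambda>b. f' (x + a *\<^sub>R u + b *\<^sub>R v) u) has_derivative (\<lambda>s. f'' (x + a *\<^sub>R u + b *\<^sub>R v) (s *\<^sub>R v))) (at b within {0..t})"
    if "0 \<le> b" "b \<le> t" for b
    by (rule has_derivative_compose[where f="\<lambda>b. x + a *\<^sub>R u + b *\<^sub>R v" and f'="\<lambda>s. s *\<^sub>R v", OF _ D2[OF a that]])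
      (auto intro!: derivative_eq_intros)
  from mvt_very_simple[of 0 t "\<lambda>b. f' (x + a *\<^sub>R u + b *\<^sub>R v) u", OF _ B] assms(1) obtain b
    where b: "0 \<le> b" "b \<le> t"
      and gb: "f' (x + a *\<^sub>R u + t *\<^sub>R v) u - f' (x + a *\<^sub>R u) u = f'' (x + a *\<^sub>R u + b *\<^sub>R v) (t *\<^sub>R v)"
    by auto
  have "g t - g 0 = t * (f' (x + a *\<^sub>R u + t *\<^sub>R v) u - f' (x + a *\<^sub>R u) u)"
    unfolding ga using linear_scale[OF l[of a t]] linear_scale[OF l[of a 0]] a assms(1)
    by (simp add: right_diff_distrib)
  also have "\<dots> = t * t * f'' (x + a *\<^sub>R u + b *\<^sub>R v) v"
    unfolding gb using linear_scale[OF l2[OF a b]] by simp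
  finally show ?thesis using that[OF a b] by (simp add: g_def)
qed

text \<open>The mixed second difference is symmetric in u and v, and equals t * t times either mixed
  derivative at suitable points close to x. Continuity of the second derivatives then brings both
  values together at x.\<close>

lemma symmetric_derivative_real:
  fixes f :: "'a::euclidean_space \<Rightarrow> real"
  assumes S: "open S" "x \<in> S" and f: "Ck_on 2 S f"
  shows "frechet_derivative (\<lambda>y. frechet_derivative f (at y) u) (at x) v =
         frechet_derivative (\<lambda>y. frechet_derivative f (at y) v) (at x) u"
proof -
  define D where "D u v y = frechet_derivative (\<lambda>y. frechet_derivative f (at y) u) (at y) v" for u v y
  have f2: "Ck_on (Suc (Suc 0)) S f" using f by (simp add: numeral_2_eq_2 del: Ck_on.simps)
  have f1: "Ck_on (Suc 0) S (\<lambda>y. frechet_derivative f (at y) u)" for u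
    using f2 by (simp del: Ck_on.simps(1))
  have cont: "continuous_on S (D u v)" for u v
    using f1[of u] unfolding D_def by simp
  have "\<bar>D u v x - D v u x\<bar> < \<epsilon>" if "0 < \<epsilon>" for \<epsilon>
  proof -
    have ev: "\<exists>d>0. \<forall>y. dist y x < d \<longrightarrow> y \<in> S \<and> \<bar>D u v y - D u v x\<bar> < \<epsilon> / 2" for u v
    proof -
      have "continuous (at x) (D u v)" using cont S continuous_on_eq_continuous_at by blast
      moreover have "0 < \<epsilon> / 2" using that by simp
      ultimately obtain d where "0 < d" "\<forall>y. dist y x < d \<longrightarrow> dist (D u v y) (D u v x) < \<epsilon> / 2"
        unfolding continuous_at_eps_delta by blast
      moreover obtain d' where "0 < d'" "\<forall>y. dist y x < d' \<longrightarrow> y \<in> S"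
        using S by (auto simp: open_dist)
      ultimately show ?thesis by (intro exI[of _ "min d d'"]) (auto simp: dist_real_def)
    qed
    obtain d1 where d1: "0 < d1" "\<And>y. dist y x < d1 \<Longrightarrow> y \<in> S \<and> \<bar>D u v y - D u v x\<bar> < \<epsilon> / 2"
      using ev by blast
    obtain d2 where d2: "0 < d2" "\<And>y. dist y x < d2 \<Longrightarrow> y \<in> S \<and> \<bar>D v u y - D v u x\<bar> < \<epsilon> / 2"
      using ev by blast
    \<comment> \<open>Chosen so that the whole parallelogram spanned by t u and t v at x stays
      within distance \<open>min d1 d2\<close>; the summand 1 keeps the denominator positive when u
      = v = 0.\<close>
    define t where "t = min d1 d2 / (2 * (norm u + norm v + 1))"
    have pos: "0 < norm u + norm v + 1"
      by (simp add: add_nonneg_pos)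
    then have t: "0 < t" using d1(1) d2(1) by (simp add: t_def)
    have near: "dist (x + a *\<^sub>R u + b *\<^sub>R v) x < min d1 d2" if "0 \<le> a" "a \<le> t" "0 \<le> b" "b \<le> t" for a b
    proof -
      have "dist (x + a *\<^sub>R u + b *\<^sub>R v) x \<le> a * norm u + b * norm v"
        using norm_triangle_ineq[of "a *\<^sub>R u" "b *\<^sub>R v"] that by (simp add: dist_norm add.assoc)
      also have "\<dots> \<le> t * norm u + t * norm v"
        using that by (intro add_mono mult_right_mono) auto
      also have "\<dots> < t * (2 * (norm u + norm v + 1))"
        using t by (simp add: algebra_simps add_pos_nonneg add_nonneg_pos)
      also have "\<dots> = min d1 d2" using pos by (simp add: t_def)
      finally show ?thesis .
    qed
    have near': "dist (x + a *\<^sub>R v + b *\<^sub>R u) x < min d1 d2" if "0 \<le> a" "a \<le> t" "0 \<le> b" "b \<le> t" for a b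
      using near[of b a] that by (simp add: add_ac)
    have DD: "((\<lambda>y. frechet_derivative f (at y) u) has_derivative (\<lambda>v. D u v y)) (at y)" if "y \<in> S" for y u
      using Ck_on_Suc_D[OF f1 that] unfolding D_def .
    obtain a b where ab: "0 \<le> a" "a \<le> t" "0 \<le> b" "b \<le> t" and
      e1: "f (x + t *\<^sub>R u + t *\<^sub>R v) - f (x + t *\<^sub>R u) - f (x + t *\<^sub>R v) + f x = t * t * D u v (x + a *\<^sub>R u + b *\<^sub>R v)"
      by (rule second_difference_mvt[OF t, of f "\<lambda>y. frechet_derivative f (at y)" x u v "\<lambda>y v. D u v y"])
        (use near d1(2) in \<open>auto intro: Ck_on_Suc_D[OF f2] DD\<close>)
    obtain a' b' where ab': "0 \<le> a'" "a' \<le> t" "0 \<le> b'" "b' \<le> t" and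
      e2: "f (x + t *\<^sub>R v + t *\<^sub>R u) - f (x + t *\<^sub>R v) - f (x + t *\<^sub>R u) + f x = t * t * D v u (x + a' *\<^sub>R v + b' *\<^sub>R u)"
      by (rule second_difference_mvt[OF t, of f "\<lambda>y. frechet_derivative f (at y)" x v u "\<lambda>y u. D v u y"])
        (use near' d1(2) in \<open>auto intro: Ck_on_Suc_D[OF f2] DD\<close>)
    have "t * t * D u v (x + a *\<^sub>R u + b *\<^sub>R v) = t * t * D v u (x + a' *\<^sub>R v + b' *\<^sub>R u)"
    proof -
      have "f (x + t *\<^sub>R u + t *\<^sub>R v) = f (x + t *\<^sub>R v + t *\<^sub>R u)" by (simp add: add_ac)
      then show ?thesis using e1 e2 by linarith
    qed
    then have "D u v (x + a *\<^sub>R u + b *\<^sub>R v) = D v u (x + a' *\<^sub>R v + b' *\<^sub>R u)" using t by simp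
    moreover have "\<bar>D u v (x + a *\<^sub>R u + b *\<^sub>R v) - D u v x\<bar> < \<epsilon> / 2" using d1(2) near[OF ab] by auto
    moreover have "\<bar>D v u (x + a' *\<^sub>R v + b' *\<^sub>R u) - D v u x\<bar> < \<epsilon> / 2" using d2(2) near'[OF ab'] by auto
    ultimately show ?thesis by linarith
  qed
  then have "\<not> 0 < \<bar>D u v x - D v u x\<bar>" using less_irrefl by blast
  then show ?thesis unfolding D_def by simp
qed

text \<open>The argument by mean values gives equalities only for real functions, so the claim is
  reduced to the components \<open>f y \<bullet> b\<close>.\<close>

lemma symmetric_derivative:
  fixes f :: "'a::euclidean_space \<Rightarrow> 'b::euclidean_space"
  assumes S: "open S" "x \<in> S" and f: "Ck_on 2 S f"
  shows "frechet_derivative (\<lambda>y. frechet_derivative f (at y) u) (at x) v =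
         frechet_derivative (\<lambda>y. frechet_derivative f (at y) v) (at x) u"
proof (rule euclidean_eqI)
  fix b :: 'b
  have l: "linear (\<lambda>z. z \<bullet> b)" by (intro linearI) (auto simp: inner_add_left)
  have f2: "Ck_on (Suc (Suc 0)) S f" using f by (simp add: numeral_2_eq_2 del: Ck_on.simps)
  have f1: "Ck_on (Suc 0) S (\<lambda>y. frechet_derivative f (at y) u)" for u
    using f2 by (simp del: Ck_on.simps(1))
  have 1: "frechet_derivative (\<lambda>y. g y \<bullet> b) (at y) w = frechet_derivative g (at y) w \<bullet> b"
    if "Ck_on (Suc k) S g" "y \<in> S" for g y w k
    using frechet_derivative_at[OF has_derivative_inner_left[OF Ck_on_Suc_D[OF that], of b]] by metis
  have 2: "frechet_derivative (\<lambda>y. frechet_derivative (\<lambda>y. f y \<bullet> b) (at y) u) (at x) v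
      = frechet_derivative (\<lambda>y. frechet_derivative f (at y) u) (at x) v \<bullet> b" for u v
  proof -
    have "((\<lambda>y. frechet_derivative f (at y) u \<bullet> b) has_derivative
       (\<lambda>v. frechet_derivative (\<lambda>y. frechet_derivative f (at y) u) (at x) v \<bullet> b)) (at x)"
      by (intro has_derivative_inner_left Ck_on_Suc_D[OF f1 S(2)])
    then have "((\<lambda>y. frechet_derivative (\<lambda>y. f y \<bullet> b) (at y) u) has_derivative
       (\<lambda>v. frechet_derivative (\<lambda>y. frechet_derivative f (at y) u) (at x) v \<bullet> b)) (at x)"
      by (rule has_derivative_transform_within_open[OF _ S]) (simp add: 1[OF f2])
    then show ?thesis using frechet_derivative_at by metis
  qed
  show "frechet_derivative (\<lambda>y. frechet_derivative f (at y) u) (at x) v \<bullet> b =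
         frechet_derivative (\<lambda>y. frechet_derivative f (at y) v) (at x) u \<bullet> b"
    using symmetric_derivative_real[OF S Ck_on_linear[OF l S(1) f], of u v] unfolding 2 .
qed

section \<open>Forms in charts\<close>

lemma frechet_derivative_apply:
  "(f has_derivative f') (at x) \<Longrightarrow> frechet_derivative f (at x) v = f' v"
  by (simp add: frechet_derivative_at[symmetric])

locale smooth_manifold =
  fixes A :: "('m::{t2_space,second_countable_topology}, 'a::euclidean_space) chart set"
  assumes atlas: "smooth_atlas A"
begin

lemma chart_open: "c \<in> A \<Longrightarrow> open (fst c)"
  using atlas by (auto simp: smooth_atlas_def)

lemma chart_homeo: "c \<in> A \<Longrightarrow> homeomorphism (fst c) (snd c ` fst c) (snd c) (chart_inv c)"
  using atlas by (auto simp: smooth_atlas_def)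

lemma chart_inv_left: "\<lbrakk>c \<in> A; x \<in> fst c\<rbrakk> \<Longrightarrow> chart_inv c (snd c x) = x"
  using chart_homeo by (metis homeomorphism_apply1)

lemma chart_image_inv:
  assumes "c \<in> A" "y \<in> snd c ` (T \<inter> fst c)"
  shows "chart_inv c y \<in> T" "chart_inv c y \<in> fst c" "snd c (chart_inv c y) = y"
proof -
  obtain x where "x \<in> T" "x \<in> fst c" "y = snd c x" using assms(2) by blast
  then show "chart_inv c y \<in> T" "chart_inv c y \<in> fst c" "snd c (chart_inv c y) = y"
    using chart_inv_left[OF assms(1)] by simp_all
qed

lemma chart_open_image:
  assumes "c \<in> A" "open U"
  shows "open (snd c ` (U \<inter> fst c))"
proof -
  have "openin (top_of_set (snd c ` fst c)) (snd c ` (U \<inter> fst c))"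
    using homeomorphism_imp_open_map[OF chart_homeo[OF assms(1)], of "U \<inter> fst c"] assms(2)
    by (auto simp: openin_open Int_commute)
  moreover have "open (snd c ` fst c)" using atlas assms(1) by (auto simp: smooth_atlas_def)
  ultimately show ?thesis using openin_open_trans by blast
qed

lemma chart_at: "chart_at A x \<in> A" "x \<in> fst (chart_at A x)"
proof -
  have "\<exists>c. c \<in> A \<and> x \<in> fst c" using atlas by (fastforce simp: smooth_atlas_def)
  then have "chart_at A x \<in> A \<and> x \<in> fst (chart_at A x)"
    unfolding chart_at_def by (rule someI_ex)
  then show "chart_at A x \<in> A" "x \<in> fst (chart_at A x)" by auto
qed

lemma transition_smooth:
  "\<lbrakk>c \<in> A; d \<in> A\<rbrakk> \<Longrightarrow> smooth_on (snd c ` (fst c \<inter> fst d)) (snd d \<circ> chart_inv c)"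
  using atlas by (auto simp: smooth_atlas_def)

lemma transition_has_derivative:
  assumes "c \<in> A" "d \<in> A" "x \<in> fst c" "x \<in> fst d"
  shows "((snd d \<circ> chart_inv c) has_derivative
    frechet_derivative (snd d \<circ> chart_inv c) (at (snd c x))) (at (snd c x))"
  using assms by (intro smooth_on_has_derivative[OF transition_smooth]) auto

lemma transition_self:
  assumes "c \<in> A" "x \<in> fst c"
  shows "frechet_derivative (snd c \<circ> chart_inv c) (at (snd c x)) v = v"
proof -
  have "(snd c \<circ> chart_inv c has_derivative (\<lambda>v. v)) (at (snd c x))"
    using assms chart_open_image[OF assms(1), of UNIV]
    by (intro has_derivative_transform_within_open[OF has_derivative_ident, of "snd c ` fst c"])
      (auto simp: chart_inv_left)
  then show ?thesis by (rule frechet_derivative_apply)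
qed

lemma transition_compose:
  assumes "c \<in> A" "d \<in> A" "c' \<in> A" "x \<in> fst c" "x \<in> fst d" "x \<in> fst c'"
  shows "frechet_derivative (snd c' \<circ> chart_inv c) (at (snd c x)) v =
    frechet_derivative (snd c' \<circ> chart_inv d) (at (snd d x))
      (frechet_derivative (snd d \<circ> chart_inv c) (at (snd c x)) v)"
proof -
  let ?f = "snd d \<circ> chart_inv c" and ?g = "snd c' \<circ> chart_inv d"
  have fx: "?f (snd c x) = snd d x" using assms by (simp add: chart_inv_left)
  have "((\<lambda>y. ?g (?f y)) has_derivative
     (\<lambda>v. frechet_derivative ?g (at (snd d x)) (frechet_derivative ?f (at (snd c x)) v))) (at (snd c x))"
    using transition_has_derivative[of d c' x] transition_has_derivative[of c d x] assms
    by (intro has_derivative_compose[where f = ?f and g = ?g]) (simp_all only: fx)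
  then have "(snd c' \<circ> chart_inv c has_derivative
     (\<lambda>v. frechet_derivative ?g (at (snd d x)) (frechet_derivative ?f (at (snd c x)) v))) (at (snd c x))"
    by (rule has_derivative_transform_within_open[of _ _ _ _ "snd c ` (fst d \<inter> fst c)"])
      (use assms chart_open chart_open_image in \<open>auto simp: chart_inv_left\<close>)
  then show ?thesis by (rule frechet_derivative_apply)
qed

lemma coord_vec_in: "\<lbrakk>c \<in> A; x \<in> fst c\<rbrakk> \<Longrightarrow> coord_vec A c x v \<in> tangent_space A x"
  unfolding tangent_space_def mem_Collect_eq
proof (intro conjI ballI allI impI)
  fix d d' assume "c \<in> A" "x \<in> fst c" "d \<in> A" "d' \<in> A" "x \<in> fst d \<inter> fst d'"
  then show "coord_vec A c x v d' =
      frechet_derivative (snd d' \<circ> chart_inv d) (at (snd d x)) (coord_vec A c x v d)"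
    using transition_compose[of c d d' x v] by (simp add: coord_vec_def)
next
  fix d assume "\<not> (d \<in> A \<and> x \<in> fst d)"
  then show "coord_vec A c x v d = 0" unfolding coord_vec_def by (rule if_not_P)
qed

lemma coord_vec_self: "\<lbrakk>c \<in> A; x \<in> fst c\<rbrakk> \<Longrightarrow> coord_vec A c x v c = v"
  using transition_self by (simp add: coord_vec_def)

lemma tangent_component_change:
  "\<lbrakk>c \<in> A; d \<in> A; x \<in> fst c; x \<in> fst d; X \<in> tangent_space A x\<rbrakk> \<Longrightarrow>
    X d = frechet_derivative (snd d \<circ> chart_inv c) (at (snd c x)) (X c)"
  unfolding tangent_space_def by blast

lemma tangent_eq_coord_vec:
  assumes "c \<in> A" "x \<in> fst c" "X \<in> tangent_space A x"
  shows "X = coord_vec A c x (X c)"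
proof
  fix d
  show "X d = coord_vec A c x (X c) d"
  proof (cases "d \<in> A \<and> x \<in> fst d")
    case True
    then show ?thesis using tangent_component_change[OF assms(1) _ assms(2) _ assms(3)]
      by (simp add: coord_vec_def)
  next
    case False
    moreover from False have "X d = 0" using assms(3) unfolding tangent_space_def by blast
    ultimately show ?thesis by (auto simp: coord_vec_def)
  qed
qed

lemma coord_vec_lincomb:
  assumes "c \<in> A" "x \<in> fst c"
  shows "coord_vec A c x (a *\<^sub>R v + b *\<^sub>R w) = (\<lambda>d. a *\<^sub>R coord_vec A c x v d + b *\<^sub>R coord_vec A c x w d)"
proof
  fix d
  show "coord_vec A c x (a *\<^sub>R v + b *\<^sub>R w) d = a *\<^sub>R coord_vec A c x v d + b *\<^sub>R coord_vec A c x w d"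
  proof (cases "d \<in> A \<and> x \<in> fst d")
    case True
    then have "linear (frechet_derivative (snd d \<circ> chart_inv c) (at (snd c x)))"
      using transition_has_derivative[OF assms(1) _ assms(2)] has_derivative_linear by blast
    then show ?thesis using True by (simp add: coord_vec_def linear_add linear_scale)
  qed (auto simp: coord_vec_def)
qed

lemma coord_vec_change:
  "\<lbrakk>c \<in> A; d \<in> A; x \<in> fst c; x \<in> fst d\<rbrakk> \<Longrightarrow> coord_vec A c x v = coord_vec A d x (coord_vec A c x v d)"
  by (rule tangent_eq_coord_vec) (auto intro: coord_vec_in)

section \<open>One-forms and exterior derivatives in a fixed chart\<close>

definition local_form :: "('m, 'a, 'e::euclidean_space) form1 \<Rightarrow> ('m, 'a) chart \<Rightarrow> 'a \<Rightarrow> 'a \<Rightarrow> 'e" where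
  "local_form \<alpha> c v = (\<lambda>y. \<alpha> (chart_inv c y) (coord_vec A c (chart_inv c y) v))"

text \<open>The chart is an argument, whereas in \<open>ext_deriv\<close> it is
  \<open>chart_at A x\<close> and may jump from point to point.\<close>

definition chart_deriv :: "('m, 'a, 'e::euclidean_space) form1 \<Rightarrow> ('m, 'a) chart \<Rightarrow> 'a \<Rightarrow> 'a \<Rightarrow> 'a \<Rightarrow> 'e" where
  "chart_deriv \<alpha> c y u v =
     frechet_derivative (local_form \<alpha> c v) (at y) u - frechet_derivative (local_form \<alpha> c u) (at y) v"

lemma ext_deriv_chart_at:
  "ext_deriv A \<alpha> x X Y = chart_deriv \<alpha> (chart_at A x) (snd (chart_at A x) x) (X (chart_at A x)) (Y (chart_at A x))"
  by (simp add: ext_deriv_def chart_deriv_def local_form_def Let_def)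

lemma form_smoothD:
  assumes "smooth_form1 A U E \<alpha>" "c \<in> A"
  shows "smooth_on (snd c ` (U \<inter> fst c)) (local_form \<alpha> c v)"
  using assms by (simp add: smooth_form1_def local_form_def)

lemma form_value:
  "\<lbrakk>smooth_form1 A U E \<alpha>; x \<in> U; X \<in> tangent_space A x\<rbrakk> \<Longrightarrow> \<alpha> x X \<in> E"
  by (simp add: smooth_form1_def)

lemma form_lincomb:
  "\<lbrakk>smooth_form1 A U E \<alpha>; x \<in> U; X \<in> tangent_space A x; Y \<in> tangent_space A x\<rbrakk> \<Longrightarrow>
    \<alpha> x (\<lambda>c. a *\<^sub>R X c + b *\<^sub>R Y c) = a *\<^sub>R \<alpha> x X + b *\<^sub>R \<alpha> x Y"
  by (simp add: smooth_form1_def)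

lemma local_form_linear:
  assumes "smooth_form1 A U E \<alpha>" "c \<in> A" "y \<in> snd c ` (U \<inter> fst c)"
  shows "linear (\<lambda>v. local_form \<alpha> c v y)"
proof -
  note y = chart_image_inv[OF assms(2,3)]
  have *: "local_form \<alpha> c (a *\<^sub>R v + b *\<^sub>R w) y = a *\<^sub>R local_form \<alpha> c v y + b *\<^sub>R local_form \<alpha> c w y" for a v b w
    unfolding local_form_def coord_vec_lincomb[OF assms(2) y(2)]
    by (rule form_lincomb[OF assms(1) y(1) coord_vec_in coord_vec_in]) (use assms y in auto)
  show ?thesis
    using *[of 1 _ 1] *[of _ _ 0 0] by (intro linearI) auto
qed

lemma local_form_value:
  assumes "smooth_form1 A U E \<alpha>" "c \<in> A" "y \<in> snd c ` (U \<inter> fst c)"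
  shows "local_form \<alpha> c v y \<in> E"
  using form_value[OF assms(1)] chart_image_inv[OF assms(2,3)] coord_vec_in assms(2)
  by (simp add: local_form_def)

lemma local_form_at:
  "\<lbrakk>c \<in> A; x \<in> fst c; X \<in> tangent_space A x\<rbrakk> \<Longrightarrow> local_form \<alpha> c (X c) (snd c x) = \<alpha> x X"
  using tangent_eq_coord_vec[of c x X] by (simp add: local_form_def chart_inv_left)

text \<open>Separates the vector from the form: a vector that varies with y then enters only through
  scalar factors in front of finitely many fixed smooth functions.\<close>

lemma local_form_expand:
  assumes "smooth_form1 A U E \<alpha>" "c \<in> A" "y \<in> snd c ` (U \<inter> fst c)"
  shows "local_form \<alpha> c v y = (\<Sum>b\<in>Basis. (v \<bullet> b) *\<^sub>R local_form \<alpha> c b y)"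
proof -
  have "local_form \<alpha> c (\<Sum>b\<in>Basis. (v \<bullet> b) *\<^sub>R b) y = (\<Sum>b\<in>Basis. (v \<bullet> b) *\<^sub>R local_form \<alpha> c b y)"
    by (simp add: linear_sum[OF local_form_linear[OF assms]] linear_scale[OF local_form_linear[OF assms]])
  then show ?thesis by (simp add: euclidean_representation)
qed

lemma local_form_deriv_expand:
  assumes "smooth_form1 A U E \<alpha>" "c \<in> A" "open U" "y \<in> snd c ` (U \<inter> fst c)"
  shows "frechet_derivative (local_form \<alpha> c v) (at y) u =
    (\<Sum>b\<in>Basis. (v \<bullet> b) *\<^sub>R frechet_derivative (local_form \<alpha> c b) (at y) u)"
proof -
  have "((\<lambda>y. \<Sum>b\<in>Basis. (v \<bullet> b) *\<^sub>R local_form \<alpha> c b y) has_derivative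
     (\<lambda>u. \<Sum>b\<in>Basis. (v \<bullet> b) *\<^sub>R frechet_derivative (local_form \<alpha> c b) (at y) u)) (at y)"
    by (intro has_derivative_sum has_derivative_scaleR_right
        smooth_on_has_derivative[OF form_smoothD[OF assms(1,2)] assms(4)])
  then have "(local_form \<alpha> c v has_derivative
     (\<lambda>u. \<Sum>b\<in>Basis. (v \<bullet> b) *\<^sub>R frechet_derivative (local_form \<alpha> c b) (at y) u)) (at y)"
    by (rule has_derivative_transform_within_open[OF _ chart_open_image[OF assms(2,3)] assms(4)])
      (rule local_form_expand[OF assms(1,2), symmetric])
  then show ?thesis by (rule frechet_derivative_apply)
qed

lemma local_form_deriv_linear:
  assumes "smooth_form1 A U E \<alpha>" "c \<in> A" "y \<in> snd c ` (U \<inter> fst c)"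
  shows "linear (frechet_derivative (local_form \<alpha> c v) (at y))"
  using smooth_on_has_derivative[OF form_smoothD[OF assms(1,2)] assms(3)] has_derivative_linear by blast

lemma chart_deriv_bilinear:
  assumes "smooth_form1 A U E \<alpha>" "c \<in> A" "open U" "y \<in> snd c ` (U \<inter> fst c)"
  shows "bilinear (chart_deriv \<alpha> c y)"
proof -
  note l = local_form_deriv_linear[OF assms(1,2,4)]
  have l': "linear (\<lambda>v. frechet_derivative (local_form \<alpha> c v) (at y) u)" for u
  proof -
    have "(\<lambda>v. frechet_derivative (local_form \<alpha> c v) (at y) u) =
        (\<lambda>v. \<Sum>b\<in>Basis. (v \<bullet> b) *\<^sub>R frechet_derivative (local_form \<alpha> c b) (at y) u)"
      by (rule ext) (rule local_form_deriv_expand[OF assms])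
    moreover have "linear \<dots>"
      by (intro linearI) (auto simp: inner_add_left scaleR_left.add sum.distrib scaleR_sum_right)
    ultimately show ?thesis by simp
  qed
  show ?thesis
    unfolding bilinear_def
  proof (intro conjI allI)
    show "linear (\<lambda>v. chart_deriv \<alpha> c y u v)" for u
      unfolding chart_deriv_def by (rule linear_compose_sub[OF l' l])
    show "linear (\<lambda>u. chart_deriv \<alpha> c y u v)" for v
      unfolding chart_deriv_def by (rule linear_compose_sub[OF l l'])
  qed
qed

text \<open>The second derivatives of the transition map enter symmetrically, hence cancel.\<close>

lemma chart_deriv_change:
  assumes \<alpha>: "smooth_form1 A U E \<alpha>" and "open U" "x \<in> U"
    and c: "c \<in> A" "x \<in> fst c" and d: "d \<in> A" "x \<in> fst d"
    and X: "X \<in> tangent_space A x" and Y: "Y \<in> tangent_space A x"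
  shows "chart_deriv \<alpha> c (snd c x) (X c) (Y c) = chart_deriv \<alpha> d (snd d x) (X d) (Y d)"
proof -
  define \<phi> where "\<phi> = snd d \<circ> chart_inv c"
  define V where "V = snd c ` ((U \<inter> fst d) \<inter> fst c)"
  define D where "D v y = frechet_derivative \<phi> (at y) v" for v y
  define y where "y = snd c x"
  have V: "open V" unfolding V_def
    by (intro chart_open_image open_Int chart_open assms c d)
  have yV: "y \<in> V" using assms by (auto simp: y_def V_def)
  have sm: "smooth_on V \<phi>" unfolding \<phi>_def V_def
    using transition_smooth[OF c(1) d(1)] by (rule smooth_on_subset) auto
  have \<phi>y: "\<phi> y = snd d x" using c by (simp add: \<phi>_def y_def chart_inv_left)
  have dV: "\<phi> z \<in> snd d ` (U \<inter> fst d)" if "z \<in> V" for z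
    using chart_image_inv[OF c(1)] that by (auto simp: \<phi>_def V_def)
  have lf: "local_form \<alpha> c v z = (\<Sum>b\<in>Basis. (D v z \<bullet> b) *\<^sub>R local_form \<alpha> d b (\<phi> z))" if "z \<in> V" for v z
  proof -
    let ?p = "chart_inv c z"
    have p: "?p \<in> U" "?p \<in> fst d" "?p \<in> fst c" "snd c ?p = z"
      using chart_image_inv[OF c(1), of z "U \<inter> fst d"] that by (auto simp: V_def)
    have "chart_inv d (\<phi> z) = ?p" using p d by (simp add: \<phi>_def chart_inv_left)
    moreover have "coord_vec A c ?p v d = D v z" using p d by (simp add: coord_vec_def D_def \<phi>_def)
    ultimately have "local_form \<alpha> c v z = local_form \<alpha> d (D v z) (\<phi> z)"
      unfolding local_form_def using coord_vec_change[OF c(1) d(1) p(3,2), of v] by simp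
    also have "\<dots> = (\<Sum>b\<in>Basis. (D v z \<bullet> b) *\<^sub>R local_form \<alpha> d b (\<phi> z))"
      by (rule local_form_expand[OF \<alpha> d(1) dV[OF that]])
    finally show ?thesis .
  qed
  have D\<phi>: "(\<phi> has_derivative (\<lambda>u. D u z)) (at z)" if "z \<in> V" for z
    unfolding D_def using smooth_on_has_derivative[OF sm that] .
  have DD: "(D v has_derivative frechet_derivative (D v) (at y)) (at y)" for v
    using smooth_on_has_derivative[OF smooth_on_derivative[OF sm] yV] unfolding D_def .
  have sym: "frechet_derivative (D v) (at y) u = frechet_derivative (D u) (at y) v" for u v
    unfolding D_def using symmetric_derivative[OF V yV] sm unfolding smooth_on_def by blast
  \<comment> \<open>Product and chain rule for \<open>lf\<close>. The sum collects the second
    derivatives of the transition map; in the last term the vector \<open>D v y\<close> is frozen at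
    the point, and this term is what \<open>chart_deriv\<close> sees in the chart d.\<close>
  have der: "frechet_derivative (local_form \<alpha> c v) (at y) u =
     (\<Sum>b\<in>Basis. (frechet_derivative (D v) (at y) u \<bullet> b) *\<^sub>R local_form \<alpha> d b (\<phi> y))
     + frechet_derivative (local_form \<alpha> d (D v y)) (at (\<phi> y)) (D u y)" for u v
  proof -
    have "((\<lambda>z. local_form \<alpha> d b (\<phi> z)) has_derivative
        (\<lambda>u. frechet_derivative (local_form \<alpha> d b) (at (\<phi> y)) (D u y))) (at y)" for b
      by (rule has_derivative_compose[OF D\<phi>[OF yV]
            smooth_on_has_derivative[OF form_smoothD[OF \<alpha> d(1)] dV[OF yV]]])
    then have "((\<lambda>z. \<Sum>b\<in>Basis. (D v z \<bullet> b) *\<^sub>R local_form \<alpha> d b (\<phi> z)) has_derivative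
      (\<lambda>u. \<Sum>b\<in>Basis. (D v y \<bullet> b) *\<^sub>R frechet_derivative (local_form \<alpha> d b) (at (\<phi> y)) (D u y)
         + (frechet_derivative (D v) (at y) u \<bullet> b) *\<^sub>R local_form \<alpha> d b (\<phi> y))) (at y)"
      by (intro has_derivative_sum has_derivative_scaleR has_derivative_inner_left DD)
    then have "(local_form \<alpha> c v has_derivative
      (\<lambda>u. \<Sum>b\<in>Basis. (D v y \<bullet> b) *\<^sub>R frechet_derivative (local_form \<alpha> d b) (at (\<phi> y)) (D u y)
         + (frechet_derivative (D v) (at y) u \<bullet> b) *\<^sub>R local_form \<alpha> d b (\<phi> y))) (at y)"
      by (rule has_derivative_transform_within_open[OF _ V yV]) (rule lf[symmetric])
    from frechet_derivative_apply[OF this]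
    have "frechet_derivative (local_form \<alpha> c v) (at y) u =
      (\<Sum>b\<in>Basis. (D v y \<bullet> b) *\<^sub>R frechet_derivative (local_form \<alpha> d b) (at (\<phi> y)) (D u y)
         + (frechet_derivative (D v) (at y) u \<bullet> b) *\<^sub>R local_form \<alpha> d b (\<phi> y))" .
    then show ?thesis
      by (simp add: sum.distrib local_form_deriv_expand[OF \<alpha> d(1) assms(2) dV[OF yV], of "D v y"])
  qed
  have DX: "D (X c) y = X d" "D (Y c) y = Y d"
    using tangent_component_change[OF c(1) d(1) c(2) d(2)] X Y by (simp_all add: D_def \<phi>_def y_def)
  show ?thesis
    unfolding chart_deriv_def y_def[symmetric] \<phi>y[symmetric] der DX sym[of "X c" "Y c"] by simp
qed

text \<open>Allows one chart to be kept on a whole neighbourhood, as needed when an exterior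
  derivative is differentiated again.\<close>

lemma ext_deriv_chart:
  assumes "smooth_form1 A U E \<alpha>" "open U" "x \<in> U" "c \<in> A" "x \<in> fst c"
    and "X \<in> tangent_space A x" "Y \<in> tangent_space A x"
  shows "ext_deriv A \<alpha> x X Y = chart_deriv \<alpha> c (snd c x) (X c) (Y c)"
  unfolding ext_deriv_chart_at
  by (rule chart_deriv_change) (use assms chart_at in auto)

end

text \<open>With a linear projection g onto E one has f = g o f near x, hence f' = g o f'. This
  keeps derivatives of forms inside a graded piece or a filtration step.\<close>

lemma derivative_in_subspace:
  fixes f :: "'a::euclidean_space \<Rightarrow> 'b::euclidean_space"
  assumes "(f has_derivative f') (at x)" "open S" "x \<in> S" "subspace E" "\<And>y. y \<in> S \<Longrightarrow> f y \<in> E"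
  shows "f' v \<in> E"
proof -
  \<comment> \<open>A right inverse of the identity on E, defined on the whole space with values in
    E, is such a projection.\<close>
  obtain g :: "'b \<Rightarrow> 'b" where g: "g ` UNIV \<subseteq> E" "linear g" "\<And>z. z \<in> E \<Longrightarrow> g z = z"
    using linear_exists_right_inverse_on[OF linear_id assms(4)] by auto
  have "((\<lambda>y. g (f y)) has_derivative (\<lambda>v. g (f' v))) (at x)"
    using g(2) assms(1) by (simp add: bounded_linear.has_derivative linear_conv_bounded_linear)
  then have "(f has_derivative (\<lambda>v. g (f' v))) (at x)"
    by (rule has_derivative_transform_within_open[OF _ assms(2,3)]) (simp add: g(3) assms(5))
  then have "f' = (\<lambda>v. g (f' v))" using assms(1) has_derivative_unique by blast
  then have "g (f' v) = f' v" by (rule fun_cong[symmetric])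
  moreover have "g (f' v) \<in> E" using g(1) by blast
  ultimately show ?thesis by simp
qed

section \<open>Graded Lie algebras and the Bianchi identity\<close>

locale graded_bracket =
  fixes br :: "'e::euclidean_space \<Rightarrow> 'e \<Rightarrow> 'e" and h :: "int \<Rightarrow> 'e set" and k :: nat
  assumes graded: "graded_lie_algebra br h k"
begin

lemma br_bilinear: "bilinear br"
  using graded by (simp add: graded_lie_algebra_def lie_algebra_def)

lemma bounded_bilinear_br: "bounded_bilinear br"
  using br_bilinear by (simp add: bilinear_conv_bounded_bilinear)

lemmas br_add_left = bilinear_ladd[OF br_bilinear]
lemmas br_add_right = bilinear_radd[OF br_bilinear]
lemmas br_diff_left = bilinear_lsub[OF br_bilinear]
lemmas br_scale_left = bilinear_lmul[OF br_bilinear]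
lemmas br_scale_right = bilinear_rmul[OF br_bilinear]
lemmas br_zero_left = bilinear_lzero[OF br_bilinear]
lemmas br_zero_right = bilinear_rzero[OF br_bilinear]
lemmas br_neg_left = bilinear_lneg[OF br_bilinear]

lemma br_sum_left: "br (\<Sum>i\<in>I. f i) Y = (\<Sum>i\<in>I. br (f i) Y)"
  by (induction I rule: infinite_finite_induct) (simp_all add: br_zero_left br_add_left)

lemma br_sum_right: "br Y (\<Sum>i\<in>I. f i) = (\<Sum>i\<in>I. br Y (f i))"
  by (induction I rule: infinite_finite_induct) (simp_all add: br_zero_right br_add_right)

lemma br_self: "br X X = 0"
  using graded by (simp add: graded_lie_algebra_def lie_algebra_def)

lemma br_swap: "br X Y = - br Y X"
proof -
  have "br (X + Y) (X + Y) = 0" by (rule br_self)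
  then have "br X Y + br Y X = 0" unfolding br_add_left br_add_right by (simp add: br_self add.commute)
  then show ?thesis by (rule eq_neg_iff_add_eq_0[THEN iffD2])
qed

lemma jacobi: "br (br X Y) Z + br (br Y Z) X + br (br Z X) Y = 0"
proof -
  have "br Z (br X Y) + br X (br Y Z) + br Y (br Z X) = 0"
    using graded by (simp add: graded_lie_algebra_def lie_algebra_def)
  moreover have "br (br X Y) Z + br (br Y Z) X + br (br Z X) Y =
      - (br Z (br X Y) + br X (br Y Z) + br Y (br Z X))"
    by (simp add: br_swap[of "br X Y" Z] br_swap[of "br Y Z" X] br_swap[of "br Z X" Y])
  ultimately show ?thesis by simp
qed

lemma subspace_h: "subspace (h q)"
  using graded by (simp add: graded_lie_algebra_def)

lemma h_outside: "q \<notin> {-1..int k - 1} \<Longrightarrow> h q = {0}"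
  using graded by (simp add: graded_lie_algebra_def)

lemma br_h: "\<lbrakk>X \<in> h r; Y \<in> h t\<rbrakk> \<Longrightarrow> br X Y \<in> h (r + t)"
  using graded by (simp add: graded_lie_algebra_def)

lemma decomposition_unique:
  assumes "\<And>q. f q \<in> h q" "\<And>q. g q \<in> h q"
    and "(\<Sum>q\<in>{-1..int k - 1}. f q) = (\<Sum>q\<in>{-1..int k - 1}. g q)"
  shows "f = g"
  using graded assms unfolding graded_lie_algebra_def by blast

text \<open>The elements whose components all have degree at least m. Calculating modulo these
  subspaces replaces projections onto single degrees.\<close>

definition fil :: "int \<Rightarrow> 'e set" where
  "fil m = {X. \<exists>f. (\<forall>q. f q \<in> h q) \<and> (\<forall>q<m. f q = 0) \<and> X = (\<Sum>q\<in>{-1..int k - 1}. f q)}"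

lemma subspace_fil: "subspace (fil m)"
proof (rule subspaceI)
  show "0 \<in> fil m"
    unfolding fil_def by (auto intro!: exI[of _ "\<lambda>_. 0"] simp: subspace_0[OF subspace_h])
  show "X + Y \<in> fil m" if XY: "X \<in> fil m" "Y \<in> fil m" for X Y
  proof -
    obtain f where f: "\<forall>q. f q \<in> h q" "\<forall>q<m. f q = 0" "X = (\<Sum>q\<in>{-1..int k - 1}. f q)"
      using XY(1) unfolding fil_def mem_Collect_eq by (elim exE conjE)
    obtain g where g: "\<forall>q. g q \<in> h q" "\<forall>q<m. g q = 0" "Y = (\<Sum>q\<in>{-1..int k - 1}. g q)"
      using XY(2) unfolding fil_def mem_Collect_eq by (elim exE conjE)
    show ?thesis unfolding fil_def mem_Collect_eq
      by (rule exI[of _ "\<lambda>q. f q + g q"])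
        (use f g in \<open>simp add: sum.distrib subspace_add[OF subspace_h]\<close>)
  qed
  show "c *\<^sub>R X \<in> fil m" if XY: "X \<in> fil m" for c X
  proof -
    obtain f where f: "\<forall>q. f q \<in> h q" "\<forall>q<m. f q = 0" "X = (\<Sum>q\<in>{-1..int k - 1}. f q)"
      using XY(1) unfolding fil_def mem_Collect_eq by (elim exE conjE)
    show ?thesis unfolding fil_def mem_Collect_eq
      by (rule exI[of _ "\<lambda>q. c *\<^sub>R f q"])
        (use f in \<open>simp add: scaleR_sum_right subspace_scale[OF subspace_h]\<close>)
  qed
qed

lemma h_in_fil: 
  assumes "m \<le> q" "X \<in> h q"
  shows "X \<in> fil m"
proof -
  \<comment> \<open>For a degree q outside the range the sum is 0, and so is X, because
    \<open>h q\<close> is then the zero space.\<close>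
  have "X = (\<Sum>r\<in>{-1..int k - 1}. if r = q then X else 0)"
    using assms(2) h_outside[of q] by (cases "q \<in> {-1..int k - 1}") auto
  then show ?thesis unfolding fil_def mem_Collect_eq
    by (intro exI[of _ "\<lambda>r. if r = q then X else 0"])
      (use assms in \<open>auto simp: subspace_0[OF subspace_h]\<close>)
qed

lemma br_fil_left:
  assumes "X \<in> fil m" "Y \<in> h r" "l \<le> m + r"
  shows "br X Y \<in> fil l"
proof -
  obtain f where f: "\<forall>q. f q \<in> h q" "\<forall>q<m. f q = 0" "X = (\<Sum>q\<in>{-1..int k - 1}. f q)"
    using assms(1) unfolding fil_def mem_Collect_eq by (elim exE conjE)
  have "br (f q) Y \<in> fil l" for q
  proof (cases "q < m")
    case True
    then show ?thesis using f by (simp add: br_zero_left subspace_0[OF subspace_fil])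
  next
    case False
    have "br (f q) Y \<in> h (q + r)" using f assms br_h by blast
    then show ?thesis by (rule h_in_fil[rotated]) (use False assms in simp)
  qed
  then show ?thesis unfolding f(3) br_sum_left by (intro subspace_sum[OF subspace_fil])
qed

text \<open>Uniqueness of the graded decomposition: X sits in degree q alone, where elements of
  \<open>fil m\<close> have component 0. This is how a single degree is finally extracted from a
  congruence.\<close>

lemma fil_inter_h:
  assumes "X \<in> fil m" "X \<in> h q" "q < m"
  shows "X = 0"
proof (cases "q \<in> {-1..int k - 1}")
  case True
  obtain f where f: "\<forall>q. f q \<in> h q" "\<forall>q<m. f q = 0" "X = (\<Sum>q\<in>{-1..int k - 1}. f q)"
    using assms(1) unfolding fil_def mem_Collect_eq by (elim exE conjE)
  have "(\<Sum>r\<in>{-1..int k - 1}. f r) = (\<Sum>r\<in>{-1..int k - 1}. if r = q then X else 0)"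
    using True f(3) by simp
  then have "f = (\<lambda>r. if r = q then X else 0)"
    by (rule decomposition_unique[rotated 2]) (use f assms in \<open>auto simp: subspace_0[OF subspace_h]\<close>)
  then have "f q = X" by simp
  then show ?thesis using f(2) assms(3) by simp
next
  case False
  then show ?thesis using h_outside assms(2) by blast
qed

text \<open>This is dF = [F, \<alpha>] for F = d\<alpha> + 1/2 [\<alpha>, \<alpha>], evaluated on
  constant vectors; the factor 1/2 is absorbed because [\<alpha>, \<alpha>](u, v) is twice the
  bracket of the two values. Second derivatives cancel by symmetry, cubic terms by the Jacobi
  identity, and the remaining terms match by antisymmetry.\<close>

lemma bianchi_identity:
  fixes \<alpha> :: "'a::euclidean_space \<Rightarrow> 'a \<Rightarrow> 'e"
  assumes V: "open V" "y \<in> V" and sm: "\<And>v. smooth_on V (\<alpha> v)"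
  defines "F \<equiv> \<lambda>u v y. frechet_derivative (\<alpha> v) (at y) u - frechet_derivative (\<alpha> u) (at y) v
      + br (\<alpha> u y) (\<alpha> v y)"
  shows "F u v differentiable (at y)"
    and "frechet_derivative (F u v) (at y) w + frechet_derivative (F v w) (at y) u
         + frechet_derivative (F w u) (at y) v =
         br (F u v y) (\<alpha> w y) + br (F v w y) (\<alpha> u y) + br (F w u y) (\<alpha> v y)"
proof -
  define D where "D v u = frechet_derivative (\<alpha> v) (at y) u" for u v
  define DD where "DD v u w = frechet_derivative (\<lambda>y. frechet_derivative (\<alpha> v) (at y) u) (at y) w" for u v w
  have d1: "(\<alpha> v has_derivative (\<lambda>u. D v u)) (at y)" for v
    unfolding D_def by (rule smooth_on_has_derivative[OF sm V(2)])
  have d2: "((\<lambda>y. frechet_derivative (\<alpha> v) (at y) u) has_derivative (\<lambda>w. DD v u w)) (at y)" for u v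
    unfolding DD_def by (rule smooth_on_has_derivative[OF smooth_on_derivative[OF sm] V(2)])
  have sym: "DD v u w = DD v w u" for u v w
    unfolding DD_def using symmetric_derivative[OF V, of "\<alpha> v"] sm[of v] by (simp add: smooth_on_def)
  have dF: "(F u v has_derivative (\<lambda>w. DD v u w - DD u v w + (br (\<alpha> u y) (D v w) + br (D u w) (\<alpha> v y)))) (at y)" for u v
    unfolding F_def
    by (intro has_derivative_add has_derivative_diff d2 bounded_bilinear.FDERIV[OF bounded_bilinear_br] d1)
  then show "F u v differentiable (at y)" by (auto simp: differentiable_def)
  have F: "F u v y = D v u - D u v + br (\<alpha> u y) (\<alpha> v y)" for u v
    by (simp add: F_def D_def)
  have J: "br (br (\<alpha> u y) (\<alpha> v y)) (\<alpha> w y) = - br (br (\<alpha> v y) (\<alpha> w y)) (\<alpha> u y) - br (br (\<alpha> w y) (\<alpha> u y)) (\<alpha> v y)"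
    using jacobi[of "\<alpha> u y" "\<alpha> v y" "\<alpha> w y"] by (simp add: algebra_simps eq_neg_iff_add_eq_0)
  show "frechet_derivative (F u v) (at y) w + frechet_derivative (F v w) (at y) u
         + frechet_derivative (F w u) (at y) v =
         br (F u v y) (\<alpha> w y) + br (F v w y) (\<alpha> u y) + br (F w u y) (\<alpha> v y)"
    unfolding frechet_derivative_apply[OF dF] F br_add_left br_diff_left J
      br_swap[of "\<alpha> u y" "D v w"] br_swap[of "\<alpha> v y" "D w u"] br_swap[of "\<alpha> w y" "D u v"]
      sym[of u v w] sym[of v w u] sym[of w u v]
    by (simp add: algebra_simps)
qed

text \<open>The index set is a parameter because two choices occur: \<open>{0..q}\<close> gives the
  total curvature, while \<open>{-1..q + 1}\<close> adds the two brackets with the soldering form,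
  so that the vanishing of the result expresses admissibility.\<close>

definition structure_form :: "(int \<Rightarrow> 'a \<Rightarrow> 'a \<Rightarrow> 'e) \<Rightarrow> int \<Rightarrow> int set \<Rightarrow> 'a::euclidean_space \<Rightarrow> 'a \<Rightarrow> 'a \<Rightarrow> 'e" where
  "structure_form a q I y u v =
     frechet_derivative (a q v) (at y) u - frechet_derivative (a q u) (at y) v
     + (\<Sum>r\<in>I. br (a r u y) (a (q - r) v y))"

text \<open>In the Bianchi identity for the sum \<open>t\<close> of all \<open>a r\<close>,
  everything except the brackets of \<Omega> with \<open>a (-1)\<close> lies in
  \<open>fil (int p - 1)\<close>. The cyclic sum of these brackets has degree p - 2, so it must
  vanish.\<close>

lemma local_bianchi:
  fixes a :: "int \<Rightarrow> 'a::euclidean_space \<Rightarrow> 'a \<Rightarrow> 'e" and p :: nat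
  assumes V: "open V" "y \<in> V"
    and sm: "\<And>r v. r \<in> {-1..int p - 1} \<Longrightarrow> smooth_on V (a r v)"
    and val: "\<And>r v y. r \<in> {-1..int p - 1} \<Longrightarrow> y \<in> V \<Longrightarrow> a r v y \<in> h r"
    and eq: "\<And>q y u v. q \<in> {-1..int p - 2} \<Longrightarrow> y \<in> V \<Longrightarrow> structure_form a q {-1..q + 1} y u v = 0"
  defines "\<Omega> \<equiv> structure_form a (int p - 1) {0..int p - 1}"
  shows "br (\<Omega> y u v) (a (-1) w y) + br (\<Omega> y v w) (a (-1) u y) + br (\<Omega> y w u) (a (-1) v y) = 0"
proof -
  define I where "I = {-1..int p - 1}"
  define t where "t v y = (\<Sum>r\<in>I. a r v y)" for v y
  define F where "F = (\<lambda>u v y. frechet_derivative (t v) (at y) u - frechet_derivative (t u) (at y) v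
      + br (t u y) (t v y))"
  define d where "d q y u v = frechet_derivative (a q v) (at y) u - frechet_derivative (a q u) (at y) v"
    for q y u v
  define G where "G q y u v = (\<Sum>r\<in>{r \<in> I. q - r \<in> I}. br (a r u y) (a (q - r) v y))" for q y u v
  have smt: "smooth_on V (t v)" for v
    unfolding t_def using sm V by (intro smooth_on_sum) (auto simp: I_def)
  have dh: "d q y u v \<in> h q" if "q \<in> I" "y \<in> V" for q y u v
    unfolding d_def using that
    by (intro subspace_diff[OF subspace_h] derivative_in_subspace[OF smooth_on_has_derivative[OF sm] V(1) _ subspace_h])
      (auto simp: I_def intro: val)
  have Gh: "G q y u v \<in> h q" if "y \<in> V" for q y u v
    unfolding G_def
  proof (rule subspace_sum[OF subspace_h])
    fix r assume "r \<in> {r \<in> I. q - r \<in> I}"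
    then have "br (a r u y) (a (q - r) v y) \<in> h (r + (q - r))"
      using that by (intro br_h val) (auto simp: I_def)
    then show "br (a r u y) (a (q - r) v y) \<in> h q" by simp
  qed
  \<comment> \<open>In total degree p - 1 a factor of degree -1 would need a partner of degree p,
    which is not in the tuple; hence the sum runs over 0, ..., p - 1 only.\<close>
  have \<Omega>: "\<Omega> y u v = d (int p - 1) y u v + G (int p - 1) y u v" for y u v
  proof -
    have "{r \<in> I. int p - 1 - r \<in> I} = {0..int p - 1}" by (auto simp: I_def)
    then show ?thesis by (simp add: \<Omega>_def structure_form_def d_def G_def)
  qed
  have low: "d q y u v + G q y u v = 0" if "q \<in> {-1..int p - 2}" "y \<in> V" for q y u v
  proof -
    have "{r \<in> I. q - r \<in> I} = {-1..q + 1}" using that by (auto simp: I_def)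
    then show ?thesis using eq[OF that, of u v] by (simp add: structure_form_def d_def G_def)
  qed
  \<comment> \<open>Sums of two degrees from I run from -2 to 2p - 2. The bound 2p - 1 ensures that
    degree p - 1 occurs in the range even for p = 0, as the splitting of the range below
    requires.\<close>
  have dF: "F u v y = (\<Sum>q\<in>I. d q y u v) + (\<Sum>q\<in>{-2..2 * int p - 1}. G q y u v)" if "y \<in> V" for u v y
  proof -
    have "(t v has_derivative (\<lambda>u. \<Sum>r\<in>I. frechet_derivative (a r v) (at y) u)) (at y)" for v
      unfolding t_def[abs_def]
      by (intro has_derivative_sum smooth_on_has_derivative[OF sm that]) (simp add: I_def)
    note t' = frechet_derivative_apply[OF this]
    have "br (t u y) (t v y) = (\<Sum>r\<in>I. br (a r u y) (t v y))"
      unfolding t_def by (rule br_sum_left)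
    also have "\<dots> = (\<Sum>r\<in>I. \<Sum>l\<in>I. br (a r u y) (a l v y))"
      unfolding t_def br_sum_right ..
    also have "\<dots> = (\<Sum>z\<in>I \<times> I. br (a (fst z) u y) (a (snd z) v y))"
      by (simp add: sum.cartesian_product case_prod_beta)
    also have "\<dots> = (\<Sum>q\<in>{-2..2 * int p - 1}. \<Sum>z\<in>{z \<in> I \<times> I. fst z + snd z = q}. br (a (fst z) u y) (a (snd z) v y))"
      by (rule sum.group[symmetric]) (auto simp: I_def)
    also have "\<dots> = (\<Sum>q\<in>{-2..2 * int p - 1}. G q y u v)"
      unfolding G_def
    proof (rule sum.cong[OF refl])
      fix q
      show "(\<Sum>z\<in>{z \<in> I \<times> I. fst z + snd z = q}. br (a (fst z) u y) (a (snd z) v y)) =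
          (\<Sum>r\<in>{r \<in> I. q - r \<in> I}. br (a r u y) (a (q - r) v y))"
        by (rule sum.reindex_bij_witness[where j = fst and i = "\<lambda>r. (r, q - r)"]) auto
    qed
    finally show ?thesis unfolding F_def t' d_def by (simp add: sum_subtractf)
  qed
  \<comment> \<open>Degree -2 contributes nothing because \<open>h (-2)\<close> is zero, and degrees
    -1 to p - 2 cancel by \<open>low\<close>. What is left besides \<Omega> is purely quadratic of
    degree at least p.\<close>
  have F\<Omega>: "F u v y - \<Omega> y u v \<in> fil (int p)" if "y \<in> V" for u v y
  proof -
    have I: "I = insert (int p - 1) {-1..int p - 2}" by (auto simp: I_def)
    have J: "{-2..2 * int p - 1} = insert (-2) (insert (int p - 1) ({-1..int p - 2} \<union> {int p..2 * int p - 1}))"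
      by auto
    have "G (-2) y u v = 0" using Gh[OF that, of "-2" u v] h_outside[of "-2"] by simp
    moreover have "(\<Sum>q\<in>{-1..int p - 2}. d q y u v) + (\<Sum>q\<in>{-1..int p - 2}. G q y u v) = 0"
      unfolding sum.distrib[symmetric] using low that by simp
    moreover have "(\<Sum>q\<in>{-2..2 * int p - 1}. G q y u v) = G (-2) y u v + G (int p - 1) y u v
       + (\<Sum>q\<in>{-1..int p - 2}. G q y u v) + (\<Sum>q\<in>{int p..2 * int p - 1}. G q y u v)"
      unfolding J by (subst sum.insert; simp)+ (subst sum.union_disjoint; auto)
    moreover have "(\<Sum>q\<in>I. d q y u v) = d (int p - 1) y u v + (\<Sum>q\<in>{-1..int p - 2}. d q y u v)"
      unfolding I by (subst sum.insert) auto
    ultimately have "F u v y - \<Omega> y u v = (\<Sum>q\<in>{int p..2 * int p - 1}. G q y u v)"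
      unfolding dF[OF that] \<Omega> by (simp add: algebra_simps)
    also have "\<dots> \<in> fil (int p)"
      by (intro subspace_sum[OF subspace_fil] h_in_fil[OF _ Gh[OF that]]) auto
    finally show ?thesis .
  qed
  have \<Omega>h: "\<Omega> y u v \<in> h (int p - 1)" if "y \<in> V" for y u v
    unfolding \<Omega> using that by (intro subspace_add[OF subspace_h] dh Gh) (auto simp: I_def)
  have fil_p: "X \<in> fil (int p - 1)" if X: "X \<in> fil (int p)" for X
    using X unfolding fil_def by fastforce
  \<comment> \<open>Needed on all of V and not only at the given point, since F is differentiated
    next and its derivative should stay in the same subspace.\<close>
  have Ff: "F u v y \<in> fil (int p - 1)" if "y \<in> V" for y u v
  proof -
    have "(F u v y - \<Omega> y u v) + \<Omega> y u v \<in> fil (int p - 1)"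
      by (intro subspace_add[OF subspace_fil] fil_p F\<Omega> h_in_fil[OF _ \<Omega>h] that) simp
    then show ?thesis by simp
  qed
  have F': "frechet_derivative (F u v) (at y) w \<in> fil (int p - 1)" for u v w
  proof (rule derivative_in_subspace[OF _ V subspace_fil Ff])
    show "(F u v has_derivative frechet_derivative (F u v) (at y)) (at y)"
      using bianchi_identity(1)[where \<alpha> = t and u = u and v = v, OF V smt] unfolding F_def frechet_derivative_works .
  qed
  \<comment> \<open>Two errors are estimated: F - \<Omega> has degree at least p and loses at most
    one degree in a bracket with \<open>t\<close>, and \<Omega> loses none in a bracket with the
    forms of degree at least 0.\<close>
  have bF: "br (F u v y) (t w y) - br (\<Omega> y u v) (a (-1) w y) \<in> fil (int p - 1)" for u v w
  proof -
    have "br (F u v y - \<Omega> y u v) (a r w y) \<in> fil (int p - 1)" if "r \<in> I" for r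
      by (rule br_fil_left[OF F\<Omega>[OF V(2)] val[OF _ V(2)]]) (use that in \<open>auto simp: I_def\<close>)
    then have 1: "br (F u v y - \<Omega> y u v) (t w y) \<in> fil (int p - 1)"
      unfolding t_def br_sum_right by (rule subspace_sum[OF subspace_fil])
    have "br (\<Omega> y u v) (a r w y) \<in> fil (int p - 1)" if "r \<in> {0..int p - 1}" for r
      by (rule h_in_fil[OF _ br_h[OF \<Omega>h[OF V(2)] val[OF _ V(2)]]]) (use that in auto)
    then have 2: "br (\<Omega> y u v) (\<Sum>r\<in>{0..int p - 1}. a r w y) \<in> fil (int p - 1)"
      unfolding br_sum_right by (rule subspace_sum[OF subspace_fil])
    have "I = insert (-1) {0..int p - 1}" by (auto simp: I_def)
    then have "t w y = a (-1) w y + (\<Sum>r\<in>{0..int p - 1}. a r w y)" by (simp add: t_def)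
    then have "br (F u v y) (t w y) - br (\<Omega> y u v) (a (-1) w y) =
      br (F u v y - \<Omega> y u v) (t w y) + br (\<Omega> y u v) (\<Sum>r\<in>{0..int p - 1}. a r w y)"
      by (simp add: br_diff_left br_add_right)
    then show ?thesis using subspace_add[OF subspace_fil 1 2] by simp
  qed
  let ?S = "br (\<Omega> y u v) (a (-1) w y) + br (\<Omega> y v w) (a (-1) u y) + br (\<Omega> y w u) (a (-1) v y)"
  have "frechet_derivative (F u v) (at y) w + frechet_derivative (F v w) (at y) u
      + frechet_derivative (F w u) (at y) v =
      br (F u v y) (t w y) + br (F v w y) (t u y) + br (F w u y) (t v y)"
    unfolding F_def by (rule bianchi_identity(2)[OF V smt])
  moreover have "frechet_derivative (F u v) (at y) w + frechet_derivative (F v w) (at y) u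
      + frechet_derivative (F w u) (at y) v \<in> fil (int p - 1)"
    by (intro subspace_add[OF subspace_fil] F')
  ultimately have "br (F u v y) (t w y) + br (F v w y) (t u y) + br (F w u y) (t v y) \<in> fil (int p - 1)"
    by simp
  from subspace_diff[OF subspace_fil this
      subspace_add[OF subspace_fil subspace_add[OF subspace_fil bF bF] bF, of u v w v w u w u v]]
  have "?S \<in> fil (int p - 1)" by (simp add: algebra_simps)
  moreover have "br (\<Omega> y u v) (a (-1) w y) \<in> h (int p - 1 + -1)" for u v w
    by (intro br_h \<Omega>h val V) auto
  then have "?S \<in> h (int p - 1 + -1)" by (intro subspace_add[OF subspace_h])
  ultimately show ?thesis by (rule fil_inter_h) simp
qed

end

section \<open>Frames and admissible tuples\<close>

lemma smooth_on_vec: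
  fixes f :: "'a::euclidean_space \<Rightarrow> 'b::euclidean_space^'n"
  assumes "open S" "\<And>i. smooth_on S (\<lambda>x. f x $ i)"
  shows "smooth_on S f"
proof -
  have "linear (axis i :: 'b \<Rightarrow> 'b^'n)" for i
    by (intro linearI) (auto simp: vec_eq_iff axis_def)
  then have "smooth_on S (\<lambda>x. axis i (f x $ i) :: 'b^'n)" for i
    by (rule smooth_on_linear) (rule assms)+
  then have "smooth_on S (\<lambda>x. \<Sum>i\<in>UNIV. axis i (f x $ i))"
    by (intro smooth_on_sum assms(1))
  moreover have "(\<lambda>x. \<Sum>i\<in>UNIV. axis i (f x $ i)) = f"
    by (auto simp: vec_eq_iff axis_def sum_component if_distrib cong: if_cong)
  ultimately show ?thesis by simp
qed

lemma smooth_on_nth: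
  fixes f :: "'a::euclidean_space \<Rightarrow> 'b::euclidean_space^'n"
  assumes "open S" "smooth_on S f"
  shows "smooth_on S (\<lambda>x. f x $ i)"
  using assms by (rule smooth_on_linear[rotated]) (intro linearI; simp)

context smooth_manifold
begin

lemma frame_in: "is_frame A x u \<Longrightarrow> u w \<in> tangent_space A x"
  unfolding is_frame_def bij_betw_def by blast

lemma frame_component_linear: "is_frame A x u \<Longrightarrow> linear (\<lambda>w. u w c)"
  unfolding is_frame_def by blast

lemma solder_frame: "is_frame A x u \<Longrightarrow> solder u (u w) = w"
  unfolding solder_def is_frame_def bij_betw_def inj_on_def by (blast intro: the_equality)

lemma frame_surj:
  assumes "is_frame A x u" "X \<in> tangent_space A x"
  obtains w where "X = u w"
  using assms unfolding is_frame_def bij_betw_def by blast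

lemma frame_solder: "\<lbrakk>is_frame A x u; X \<in> tangent_space A x\<rbrakk> \<Longrightarrow> u (solder u X) = X"
  using frame_surj solder_frame by metis

lemma frame_lincomb: "is_frame A x u \<Longrightarrow> u (a *\<^sub>R v + b *\<^sub>R w) = (\<lambda>c. a *\<^sub>R u v c + b *\<^sub>R u w c)"
  by (rule ext) (simp add: linear_add[OF frame_component_linear] linear_scale[OF frame_component_linear])

lemma solder_lincomb:
  assumes "is_frame A x u" "X \<in> tangent_space A x" "Y \<in> tangent_space A x"
  shows "solder u (\<lambda>c. a *\<^sub>R X c + b *\<^sub>R Y c) = a *\<^sub>R solder u X + b *\<^sub>R solder u Y"
proof -
  have "(\<lambda>c. a *\<^sub>R X c + b *\<^sub>R Y c) = u (a *\<^sub>R solder u X + b *\<^sub>R solder u Y)"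
    unfolding frame_lincomb[OF assms(1)] frame_solder[OF assms(1,2)] frame_solder[OF assms(1,3)] ..
  then show ?thesis by (simp add: solder_frame[OF assms(1)])
qed

end


locale framed_manifold = smooth_manifold A
  for A :: "('m::{t2_space,second_countable_topology}, real^'n) chart set" +
  fixes P :: "('m \<times> ('m, real^'n) frame) set" and U :: "'m set" and s :: "'m \<Rightarrow> ('m, real^'n) frame"
  assumes frames: "P \<subseteq> frame_bundle A" and U_open: "open U" and smooth_s: "smooth_section A P U s"
begin

lemma frame_s: "x \<in> U \<Longrightarrow> is_frame A x (s x)"
  using frames smooth_s by (auto simp: smooth_section_def frame_bundle_def)

lemma section_smooth: "c \<in> A \<Longrightarrow> smooth_on (snd c ` (U \<inter> fst c)) (\<lambda>y. s (chart_inv c y) w c)"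
  using smooth_s by (simp add: smooth_section_def)

text \<open>A tangent vector is determined by its component in a single chart, so the chart
  components of a frame inherit its injectivity.\<close>

lemma frame_matrix_nonsingular:
  assumes "c \<in> A" "x \<in> U" "x \<in> fst c"
  shows "det (matrix (\<lambda>w. s x w c)) \<noteq> 0"
proof -
  note l = frame_component_linear[OF frame_s[OF assms(2)], of c]
  have "inj (\<lambda>w. s x w c)"
  proof (rule injI)
    fix w w' assume "s x w c = s x w' c"
    then have "s x w = s x w'"
      using tangent_eq_coord_vec[OF assms(1,3) frame_in[OF frame_s[OF assms(2)]]] by metis
    then show "w = w'" using solder_frame[OF frame_s[OF assms(2)]] by metis
  qed
  then show ?thesis using det_nz_iff_inj[OF l] by simp
qed

text \<open>Cramer's rule expresses the soldering form of a section rationally in the components of the frame.\<close>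

lemma solder_smooth:
  assumes c: "c \<in> A"
  shows "smooth_on (snd c ` (U \<inter> fst c))
    (\<lambda>y. solder (s (chart_inv c y)) (coord_vec A c (chart_inv c y) v))"
proof -
  define M where "M y = matrix (\<lambda>w. s (chart_inv c y) w c)" for y
  note o = chart_open_image[OF c U_open]
  have Ms: "smooth_on (snd c ` (U \<inter> fst c)) (\<lambda>y. M y $ i $ l)" for i l
    using smooth_on_nth[OF o section_smooth[OF c]] by (simp add: M_def matrix_def)
  have det: "det (M y) \<noteq> 0" if "y \<in> snd c ` (U \<inter> fst c)" for y
    unfolding M_def by (rule frame_matrix_nonsingular[OF c]) (use chart_image_inv[OF c that] in auto)
  have eq: "solder (s (chart_inv c y)) (coord_vec A c (chart_inv c y) v) =
     (\<chi> k. det (\<chi> i l. if l = k then v $ i else M y $ i $ l) / det (M y))"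
    if y: "y \<in> snd c ` (U \<inter> fst c)" for y
  proof -
    let ?x = "chart_inv c y"
    note x = chart_image_inv[OF c y]
    note f = frame_s[OF x(1)]
    have "s ?x (solder (s ?x) (coord_vec A c ?x v)) c = v"
      unfolding frame_solder[OF f coord_vec_in[OF c x(2)]] by (rule coord_vec_self[OF c x(2)])
    then have "M y *v solder (s ?x) (coord_vec A c ?x v) = v"
      unfolding M_def by (simp add: fun_cong[OF matrix_vector_mul(2)[OF frame_component_linear[OF f]]])
    then show ?thesis using cramer[OF det[OF y]] by blast
  qed
  have "smooth_on (snd c ` (U \<inter> fst c)) (\<lambda>y. \<chi> k. det (\<chi> i l. if l = k then v $ i else M y $ i $ l) / det (M y))"
  proof (rule smooth_on_vec[OF o])
    fix k
    have "smooth_on (snd c ` (U \<inter> fst c)) (\<lambda>y. det (\<chi> i l. if l = k then v $ i else M y $ i $ l))"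
    proof (rule smooth_on_det[OF o])
      fix i l
      show "smooth_on (snd c ` (U \<inter> fst c)) (\<lambda>y. (\<chi> i l. if l = k then v $ i else M y $ i $ l) $ i $ l)"
        using Ms[of i l] by (cases "l = k") (simp_all add: smooth_on_const)
    qed
    then show "smooth_on (snd c ` (U \<inter> fst c))
        (\<lambda>y. (\<chi> k. det (\<chi> i l. if l = k then v $ i else M y $ i $ l) / det (M y)) $ k)"
      using smooth_on_divide[OF o _ smooth_on_det[OF o Ms] det] by simp
  qed
  then show ?thesis by (rule smooth_on_cong[OF o]) (rule eq[symmetric])
qed

lemma solder_form_smooth:
  fixes e :: "real^'n \<Rightarrow> 'e::euclidean_space"
  assumes e: "linear e" "\<And>w. e w \<in> E"
  shows "smooth_form1 A U E (\<lambda>x X. e (solder (s x) X))"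
  unfolding smooth_form1_def
proof (intro conjI ballI allI)
  fix x X Y a b assume "x \<in> U" "X \<in> tangent_space A x" "Y \<in> tangent_space A x"
  then show "e (solder (s x) (\<lambda>c. a *\<^sub>R X c + b *\<^sub>R Y c)) = a *\<^sub>R e (solder (s x) X) + b *\<^sub>R e (solder (s x) Y)"
    by (simp add: solder_lincomb[OF frame_s] linear_add[OF e(1)] linear_scale[OF e(1)])
next
  fix c v assume c: "c \<in> A"
  show "smooth_on (snd c ` (U \<inter> fst c)) (\<lambda>y. e (solder (s (chart_inv c y)) (coord_vec A c (chart_inv c y) v)))"
    by (rule smooth_on_linear[OF e(1) chart_open_image[OF c U_open] solder_smooth[OF c]])
qed (rule e(2))

end

context smooth_manifold
begin

lemma local_form_smooth:
  assumes "smooth_form1 A U E \<alpha>" "open U" "c \<in> A" "smooth_on (snd c ` (U \<inter> fst c)) X"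
  shows "smooth_on (snd c ` (U \<inter> fst c)) (\<lambda>y. local_form \<alpha> c (X y) y)"
proof -
  note o = chart_open_image[OF assms(3,2)]
  have "linear (\<lambda>v. v \<bullet> b)" for b :: 'a by (intro linearI) (auto simp: inner_add_left)
  then have "smooth_on (snd c ` (U \<inter> fst c)) (\<lambda>y. \<Sum>b\<in>Basis. (X y \<bullet> b) *\<^sub>R local_form \<alpha> c b y)"
    by (intro smooth_on_sum smooth_on_scaleR form_smoothD[OF assms(1,3)] o)
      (rule smooth_on_linear[OF _ o assms(4)])
  then show ?thesis
    by (rule smooth_on_cong[OF o]) (rule local_form_expand[OF assms(1,3), symmetric])
qed

text \<open>The vector \<open>Y y\<close> is frozen while the derivative is taken, so this is not
  the derivative of one function of y. Expanding both vectors in the basis leaves derivatives of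
  fixed coefficient functions.\<close>

lemma local_form_deriv_smooth:
  assumes "smooth_form1 A U E \<alpha>" "open U" "c \<in> A"
    and X: "smooth_on (snd c ` (U \<inter> fst c)) X" and Y: "smooth_on (snd c ` (U \<inter> fst c)) Y"
  shows "smooth_on (snd c ` (U \<inter> fst c)) (\<lambda>y. frechet_derivative (local_form \<alpha> c (Y y)) (at y) (X y))"
proof -
  note o = chart_open_image[OF assms(3,2)]
  have l: "linear (\<lambda>v. v \<bullet> b)" for b :: 'a by (intro linearI) (auto simp: inner_add_left)
  have "smooth_on (snd c ` (U \<inter> fst c)) (\<lambda>y. \<Sum>b\<in>Basis. (Y y \<bullet> b) *\<^sub>R
      (\<Sum>b'\<in>Basis. (X y \<bullet> b') *\<^sub>R frechet_derivative (local_form \<alpha> c b) (at y) b'))"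
    by (intro smooth_on_sum smooth_on_scaleR smooth_on_derivative form_smoothD[OF assms(1,3)] o)
      (rule smooth_on_linear[OF l o X] smooth_on_linear[OF l o Y])+
  then show ?thesis
  proof (rule smooth_on_cong[OF o])
    fix y assume y: "y \<in> snd c ` (U \<inter> fst c)"
    note l' = local_form_deriv_linear[OF assms(1,3) y]
    have "frechet_derivative (local_form \<alpha> c b) (at y) (\<Sum>b'\<in>Basis. (X y \<bullet> b') *\<^sub>R b') =
      (\<Sum>b'\<in>Basis. (X y \<bullet> b') *\<^sub>R frechet_derivative (local_form \<alpha> c b) (at y) b')" for b
      by (simp add: linear_sum[OF l'] linear_scale[OF l'])
    then have "frechet_derivative (local_form \<alpha> c b) (at y) (X y) =
      (\<Sum>b'\<in>Basis. (X y \<bullet> b') *\<^sub>R frechet_derivative (local_form \<alpha> c b) (at y) b')" for b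
      by (simp add: euclidean_representation)
    then show "(\<Sum>b\<in>Basis. (Y y \<bullet> b) *\<^sub>R
      (\<Sum>b'\<in>Basis. (X y \<bullet> b') *\<^sub>R frechet_derivative (local_form \<alpha> c b) (at y) b')) =
      frechet_derivative (local_form \<alpha> c (Y y)) (at y) (X y)"
      unfolding local_form_deriv_expand[OF assms(1,3,2) y, of "Y y"] by simp
  qed
qed

end

section \<open>Structure equations and curvature of an admissible tuple\<close>

locale relative_bracket = graded_bracket br h k
  for br :: "'e::euclidean_space \<Rightarrow> 'e \<Rightarrow> 'e" and h k +
  fixes e :: "real^'n \<Rightarrow> 'e"
  assumes linear_e: "linear e" and e_h: "e w \<in> h (-1)"

locale admissible_tuple = smooth_manifold A + relative_bracket br h k e
  for A :: "('m::{t2_space,second_countable_topology}, real^'n) chart set"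
    and br :: "'e::euclidean_space \<Rightarrow> 'e \<Rightarrow> 'e" and h k and e :: "real^'n \<Rightarrow> 'e" +
  fixes P :: "('m \<times> ('m, real^'n) frame) set" and p :: nat
    and U :: "'m set" and s :: "'m \<Rightarrow> ('m, real^'n) frame" and \<omega> :: "int \<Rightarrow> ('m, real^'n, 'e) form1"
  assumes frames: "P \<subseteq> frame_bundle A"
    and adm: "admissible A P br h e p U s \<omega>"
begin

sublocale framed_manifold A P U s
  using frames adm unfolding admissible_def by unfold_locales blast+

lemma form_smooth: "r \<in> {0..int p - 1} \<Longrightarrow> smooth_form1 A U (h r) (\<omega> r)"
  by (rule bspec[OF conjunct1[OF conjunct2[OF conjunct2[OF adm[unfolded admissible_def]]]]])

lemma admissible_equation:
  "\<lbrakk>q \<in> {0..int p - 1}; x \<in> U; X \<in> tangent_space A x; Y \<in> tangent_space A x\<rbrakk> \<Longrightarrow>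
    total_curvature A br e s \<omega> (q - 1) x X Y = - bracket_form br (full_tuple e s \<omega> (-1)) (\<omega> q) x X Y"
  by (rule bspec[OF bspec[OF bspec[OF bspec[OF
      conjunct2[OF conjunct2[OF conjunct2[OF adm[unfolded admissible_def]]]]]]]])

abbreviation "full \<equiv> full_tuple e s \<omega>"

lemma full_smooth: 
  assumes "r \<in> {-1..int p - 1}"
  shows "smooth_form1 A U (h r) (full r)"
proof (cases "r = -1")
  case True
  then show ?thesis using solder_form_smooth[OF linear_e, of "h (-1)"] e_h by (simp add: full_tuple_def)
next
  case False
  then have "r \<in> {0..int p - 1}" using assms by auto
  from form_smooth[OF this] show ?thesis using False by (simp add: full_tuple_def)
qed

lemma full_solder: "x \<in> U \<Longrightarrow> full (-1) x (s x w) = e w"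
  by (simp add: full_tuple_def solder_frame[OF frame_s])

text \<open>The substitution r -> q - r together with antisymmetry of the bracket shows that the two
  halves of the sum of bracket forms coincide, which cancels the factor 1/2.\<close>

lemma half_bracket_sum:
  "(1/2) *\<^sub>R (\<Sum>r\<in>{0..q}. bracket_form br (f r) (f (q - r)) x X Y) =
   (\<Sum>r\<in>{0..q}. br (f r x X) (f (q - r) x Y))" for q :: int
proof -
  have "(\<Sum>r\<in>{0..q}. br (f r x Y) (f (q - r) x X)) = (\<Sum>r\<in>{0..q}. br (f (q - r) x Y) (f r x X))"
    by (rule sum.reindex_bij_witness[where i = "\<lambda>r. q - r" and j = "\<lambda>r. q - r"]) auto
  also have "\<dots> = - (\<Sum>r\<in>{0..q}. br (f r x X) (f (q - r) x Y))"
    unfolding sum_negf[symmetric] by (rule sum.cong[OF refl]) (rule br_swap)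
  finally show ?thesis
    unfolding bracket_form_def sum_subtractf by (simp add: scaleR_2[symmetric])
qed

lemma total_curvature_chart:
  assumes q: "q \<in> {-1..int p - 1}" and x: "x \<in> U" "c \<in> A" "x \<in> fst c"
    and X: "X \<in> tangent_space A x" and Y: "Y \<in> tangent_space A x"
  shows "total_curvature A br e s \<omega> q x X Y =
    structure_form (\<lambda>r. local_form (full r) c) q {0..q} (snd c x) (X c) (Y c)"
  unfolding total_curvature_def half_bracket_sum structure_form_def
    ext_deriv_chart[OF full_smooth[OF q] U_open x X Y] chart_deriv_def
  by (simp only: local_form_at[OF x(2,3) X] local_form_at[OF x(2,3) Y])

text \<open>The right-hand side of the admissibility equation, moved to the left, supplies precisely
  the terms r = -1 and r = q + 1. The index is shifted by one against \<open>admissible\<close>: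
  here q is the degree of the equation.\<close>

lemma structure_equation:
  assumes q: "q \<in> {-1..int p - 2}" and c: "c \<in> A" and y: "y \<in> snd c ` (U \<inter> fst c)"
  shows "structure_form (\<lambda>r. local_form (full r) c) q {-1..q + 1} y u v = 0"
proof -
  define x where "x = chart_inv c y"
  note x = chart_image_inv[OF c y, folded x_def]
  define X where "X = coord_vec A c x u"
  define Y where "Y = coord_vec A c x v"
  have X: "X \<in> tangent_space A x" "X c = u" and Y: "Y \<in> tangent_space A x" "Y c = v"
    unfolding X_def Y_def by (intro coord_vec_in coord_vec_self c x)+
  let ?a = "\<lambda>r. local_form (full r) c"
  have a: "?a r u y = full r x X" "?a r v y = full r x Y" for r
    using local_form_at[OF c x(2) X(1)] local_form_at[OF c x(2) Y(1)] by (simp_all add: X Y x)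
  have "q + 1 \<in> {0..int p - 1}" using q by auto
  from admissible_equation[OF this x(1) X(1) Y(1)]
  have "total_curvature A br e s \<omega> q x X Y = - bracket_form br (full (-1)) (\<omega> (q + 1)) x X Y"
    by simp
  moreover have "\<omega> (q + 1) = full (q + 1)" using q by (simp add: full_tuple_def)
  moreover have "total_curvature A br e s \<omega> q x X Y = structure_form ?a q {0..q} y u v"
    using total_curvature_chart[OF _ x(1) c x(2) X(1) Y(1), of q] q by (simp add: X Y x)
  ultimately have "structure_form ?a q {0..q} y u v
     + (br (?a (-1) u y) (?a (q + 1) v y) + br (?a (q + 1) u y) (?a (-1) v y)) = 0"
    unfolding a bracket_form_def using br_swap[of "full (-1) x Y" "full (q + 1) x X"] by simp
  moreover have "{-1..q + 1} = insert (-1) (insert (q + 1) {0..q})" using q by auto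
  ultimately show ?thesis using q by (simp add: structure_form_def algebra_simps)
qed

text \<open>\<open>local_bianchi\<close> holds for constant vectors in a chart. It is applied at the
  one point x to the chart components of the frame vectors there, so these need not be extended to
  vector fields along s.\<close>

lemma curvature_bianchi:
  assumes x: "x \<in> U"
  defines "\<Omega> \<equiv> \<lambda>u v. total_curvature A br e s \<omega> (int p - 1) x (s x u) (s x v)"
  shows "br (\<Omega> u v) (e w) + br (\<Omega> v w) (e u) + br (\<Omega> w u) (e v) = 0"
proof -
  define c where "c = chart_at A x"
  have c: "c \<in> A" "x \<in> fst c" unfolding c_def by (rule chart_at)+
  let ?V = "snd c ` (U \<inter> fst c)" and ?a = "\<lambda>r. local_form (full r) c"
  define y where "y = snd c x"
  let ?S = "structure_form ?a (int p - 1) {0..int p - 1} y"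
  have y: "y \<in> ?V" using x c by (auto simp: y_def)
  have \<Omega>: "\<Omega> u v = ?S (s x u c) (s x v c)" for u v
    unfolding \<Omega>_def y_def by (rule total_curvature_chart) (use x c frame_in[OF frame_s[OF x]] in auto)
  have e: "e w = ?a (-1) (s x w c) y" for w
    by (simp only: y_def local_form_at[OF c frame_in[OF frame_s[OF x]]] full_solder[OF x])
  have "br (?S (s x u c) (s x v c)) (?a (-1) (s x w c) y) + br (?S (s x v c) (s x w c)) (?a (-1) (s x u c) y)
      + br (?S (s x w c) (s x u c)) (?a (-1) (s x v c) y) = 0"
  proof (rule local_bianchi[OF chart_open_image[OF c(1) U_open] y])
    show "smooth_on ?V (?a r v)" if "r \<in> {-1..int p - 1}" for r v
      using form_smoothD[OF full_smooth[OF that] c(1)] .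
    show "?a r v y \<in> h r" if "r \<in> {-1..int p - 1}" "y \<in> ?V" for r v y
      using local_form_value[OF full_smooth[OF that(1)] c(1) that(2)] .
  qed (rule structure_equation[OF _ c(1)])
  then show ?thesis unfolding \<Omega>[symmetric] e[symmetric] .
qed

lemma structure_form_bilinear:
  assumes q: "q \<in> {-1..int p - 1}" and c: "c \<in> A" and y: "y \<in> snd c ` (U \<inter> fst c)"
  shows "bilinear (structure_form (\<lambda>r. local_form (full r) c) q {0..q} y)"
proof -
  let ?a = "\<lambda>r. local_form (full r) c"
  have l: "linear (\<lambda>v. ?a r v y)" if "r \<in> {0..q}" for r
    using q that by (intro local_form_linear[OF full_smooth _ y] c) auto
  have l': "linear (\<lambda>v. ?a (q - r) v y)" if "r \<in> {0..q}" for r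
    using l[of "q - r"] that by simp
  have sf: "structure_form ?a q {0..q} y u v = chart_deriv (full q) c y u v + (\<Sum>r\<in>{0..q}. br (?a r u y) (?a (q - r) v y))" for u v
    by (simp add: structure_form_def chart_deriv_def)
  note b = chart_deriv_bilinear[OF full_smooth[OF q] c U_open y]
  show ?thesis
    unfolding bilinear_def sf
  proof (intro conjI allI linear_compose_add linear_compose_sum ballI)
    show "linear (chart_deriv (full q) c y u)" for u using b by (simp add: bilinear_def)
    show "linear (\<lambda>u. chart_deriv (full q) c y u v)" for v using b by (simp add: bilinear_def)
    show "linear (\<lambda>v. br (?a r u y) (?a (q - r) v y))" if "r \<in> {0..q}" for u r
      using linear_compose[OF l'[OF that], of "br (?a r u y)"] br_bilinear
      by (simp add: bilinear_def comp_def)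
    show "linear (\<lambda>u. br (?a r u y) (?a (q - r) v y))" if "r \<in> {0..q}" for v r
      using linear_compose[OF l[OF that], of "\<lambda>X. br X (?a (q - r) v y)"] br_bilinear
      by (simp add: bilinear_def comp_def)
  qed
qed

definition curv :: "'m \<Rightarrow> real^'n \<Rightarrow> real^'n \<Rightarrow> 'e" where
  "curv x v w = total_curvature A br e s \<omega> (int p - 1) x (s x v) (s x w)"

lemma curv_chart:
  assumes "c \<in> A" "x \<in> U" "x \<in> fst c"
  shows "curv x v w = structure_form (\<lambda>r. local_form (full r) c) (int p - 1) {0..int p - 1}
      (snd c x) (s x v c) (s x w c)"
  unfolding curv_def
  by (rule total_curvature_chart) (use assms frame_in[OF frame_s[OF assms(2)]] in auto)

lemma curv_bilinear:
  assumes x: "x \<in> U"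
  shows "bilinear (curv x)"
proof -
  define c where "c = chart_at A x"
  have c: "c \<in> A" "x \<in> fst c" unfolding c_def by (rule chart_at)+
  let ?B = "structure_form (\<lambda>r. local_form (full r) c) (int p - 1) {0..int p - 1} (snd c x)"
  have "bilinear ?B" by (rule structure_form_bilinear) (use x c in auto)
  moreover note frame_component_linear[OF frame_s[OF x], of c]
  ultimately have "bilinear (\<lambda>v w. ?B (s x v c) (s x w c))"
    unfolding bilinear_def
    using linear_compose[of "\<lambda>v. s x v c" "\<lambda>v. ?B v (s x w c)" for w]
      linear_compose[of "\<lambda>v. s x v c" "?B (s x w c)" for w]
    by (simp add: comp_def)
  then show ?thesis unfolding curv_chart[OF c(1) x c(2), abs_def] .
qed

text \<open>The formulas for \<open>ext_deriv\<close> and \<open>bracket_form\<close> cancel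
  literally when both vectors coincide.\<close>

lemma curv_self: "curv x v v = 0"
  by (simp add: curv_def total_curvature_def ext_deriv_def bracket_form_def Let_def)

lemma curv_swap:
  assumes "x \<in> U"
  shows "curv x v w = - curv x w v"
proof -
  have "curv x (v + w) (v + w) = 0" by (rule curv_self)
  then have "curv x v w + curv x w v = 0"
    unfolding bilinear_ladd[OF curv_bilinear[OF assms]] bilinear_radd[OF curv_bilinear[OF assms]]
    by (simp add: curv_self add.commute)
  then show ?thesis by (rule eq_neg_iff_add_eq_0[THEN iffD2])
qed

lemma curv_h:
  assumes x: "x \<in> U"
  shows "curv x v w \<in> h (int p - 1)"
proof -
  define c where "c = chart_at A x"
  have c: "c \<in> A" "x \<in> fst c" unfolding c_def by (rule chart_at)+
  have y: "snd c x \<in> snd c ` (U \<inter> fst c)" using x c by auto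
  have d: "frechet_derivative (local_form (full (int p - 1)) c u') (at (snd c x)) u \<in> h (int p - 1)" for u u'
    using derivative_in_subspace[OF smooth_on_has_derivative[OF form_smoothD[OF full_smooth c(1)] y]
        chart_open_image[OF c(1) U_open] y subspace_h local_form_value[OF full_smooth c(1)]] by simp
  have b: "br (local_form (full r) c u (snd c x)) (local_form (full (int p - 1 - r)) c v (snd c x)) \<in> h (int p - 1)"
    if "r \<in> {0..int p - 1}" for r u v
    using br_h[OF local_form_value[OF full_smooth c(1) y] local_form_value[OF full_smooth c(1) y],
        of r "int p - 1 - r"] that by simp
  show ?thesis unfolding curv_chart[OF c(1) x c(2)] structure_form_def
    by (intro subspace_add[OF subspace_h] subspace_diff[OF subspace_h] subspace_sum[OF subspace_h] d b)
qed

lemma curv_smooth: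
  assumes c: "c \<in> A"
  shows "smooth_on (snd c ` (U \<inter> fst c)) (\<lambda>y. curv (chart_inv c y) v w)"
proof -
  note o = chart_open_image[OF c U_open]
  let ?f = "\<lambda>v y. s (chart_inv c y) v c"
  have "smooth_on (snd c ` (U \<inter> fst c)) (\<lambda>y. structure_form (\<lambda>r. local_form (full r) c) (int p - 1) {0..int p - 1}
      y (?f v y) (?f w y))"
    unfolding structure_form_def
    by (intro smooth_on_add smooth_on_diff smooth_on_sum smooth_on_bilinear[OF bounded_bilinear_br] o
        local_form_deriv_smooth[OF full_smooth U_open c] local_form_smooth[OF full_smooth U_open c]
        section_smooth[OF c]) auto
  then show ?thesis
  proof (rule smooth_on_cong[OF o])
    fix y assume "y \<in> snd c ` (U \<inter> fst c)"
    note y = chart_image_inv[OF c this]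
    show "structure_form (\<lambda>r. local_form (full r) c) (int p - 1) {0..int p - 1} y (?f v y) (?f w y) = curv (chart_inv c y) v w"
      unfolding curv_chart[OF c y(1,2)] y(3) ..
  qed
qed

text \<open>The domain, the section and the lower forms are kept and only a form of degree p is
  added. The primitives in the hypothesis may vary arbitrarily with x; they show solvability and are
  replaced by a smooth choice.\<close>

lemma extend_admissible:
  assumes ex: "\<And>x. x \<in> U \<Longrightarrow> \<exists>\<eta>. linear \<eta> \<and> (\<forall>v. \<eta> v \<in> h (int p)) \<and>
      (\<forall>v w. curv x v w = br (\<eta> w) (e v) - br (\<eta> v) (e w))"
  shows "\<exists>\<omega>'. admissible A P br h e (p + 1) U s \<omega>'"
proof -
  \<comment> \<open>Minus the coboundary operator, with a 1-cochain stored as its values on the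
    standard basis. It is the same map at every point, since \<open>e\<close> is fixed and the
    frames absorb the dependence on x.\<close>
  define L :: "'e^'n \<Rightarrow> 'e^'n^'n" where
    "L c = (\<chi> i l. br (c $ l) (e (axis i 1)) - br (c $ i) (e (axis l 1)))" for c
  define S :: "('e^'n) set" where "S = {c. \<forall>i. c $ i \<in> h (int p)}"
  have "linear L"
    by (intro linearI) (auto simp: L_def vec_eq_iff br_add_left br_scale_left scaleR_diff_right)
  moreover have "subspace S"
    unfolding S_def
    by (intro subspaceI) (auto simp: subspace_0[OF subspace_h] subspace_add[OF subspace_h] subspace_scale[OF subspace_h])
  \<comment> \<open>R inverts L only on the image of S, but is linear on the whole space with values
    in S. Hence the new form is smooth and has values in \<open>h (int p)\<close> by
    construction.\<close>
  ultimately obtain R where R: "R ` UNIV \<subseteq> S" "linear R" "\<And>z. z \<in> L ` S \<Longrightarrow> L (R z) = z"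
    using linear_exists_right_inverse_on[of L S] by auto
  define C where "C x = (\<chi> i l. curv x (axis i 1) (axis l 1))" for x
  define \<eta> where "\<eta> x w = (\<Sum>i\<in>UNIV. (w $ i) *\<^sub>R (R (C x) $ i))" for x w
  define \<omega>' where "\<omega>' = fun_upd \<omega> (int p) (\<lambda>x X. \<eta> x (solder (s x) X))"
  have RS: "R z $ i \<in> h (int p)" for z i using R(1) by (auto simp: S_def)
  have \<eta>_lin: "linear (\<eta> x)" for x
    unfolding \<eta>_def by (intro linearI) (auto simp: scaleR_add_left sum.distrib scaleR_sum_right)
  have \<eta>_axis: "\<eta> x (axis i 1) = R (C x) $ i" for x i
    unfolding \<eta>_def axis_def by (simp add: if_distrib if_distribR cong: if_cong)
  have curv_eq: "curv x v w = br (\<eta> x w) (e v) - br (\<eta> x v) (e w)" if x: "x \<in> U" for x v w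
  proof -
    \<comment> \<open>The primitive \<zeta> serves only to show that \<open>C x\<close> lies in the
      image of S under L, where R is a right inverse.\<close>
    obtain \<zeta> where \<zeta>: "linear \<zeta>" "\<forall>v. \<zeta> v \<in> h (int p)" "\<forall>v w. curv x v w = br (\<zeta> w) (e v) - br (\<zeta> v) (e w)"
      using ex[OF x] by blast
    have "C x = L (\<chi> i. \<zeta> (axis i 1))" using \<zeta>(3) by (simp add: C_def L_def vec_eq_iff)
    moreover have "(\<chi> i. \<zeta> (axis i 1)) \<in> S" using \<zeta>(2) by (simp add: S_def)
    ultimately have "L (R (C x)) = C x" using R(3) by blast
    then have ax: "curv x (axis i 1) (axis l 1) = br (\<eta> x (axis l 1)) (e (axis i 1)) - br (\<eta> x (axis i 1)) (e (axis l 1))" for i l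
      unfolding L_def C_def vec_eq_iff \<eta>_axis by (simp add: C_def)
    let ?B = "\<lambda>v w. br (\<eta> x w) (e v) - br (\<eta> x v) (e w)"
    have l2: "linear (?B v)" "linear (\<lambda>v. ?B v w)" for v w
      by (intro linearI; simp add: linear_add[OF \<eta>_lin] linear_add[OF linear_e] linear_scale[OF \<eta>_lin]
          linear_scale[OF linear_e] br_add_left br_add_right br_scale_left br_scale_right scaleR_diff_right)+
    have "curv x = ?B"
    proof (rule bilinear_eq_stdbasis[OF curv_bilinear[OF x]])
      show "bilinear ?B" using l2 by (simp add: bilinear_def)
      show "curv x i l = ?B i l" if "i \<in> Basis" "l \<in> Basis" for i l
        using that ax by (auto simp: Basis_vec_def)
    qed
    then show ?thesis by (rule fun_cong[OF fun_cong, of _ ?B])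
  qed
  have smooth\<eta>: "smooth_form1 A U (h (int p)) (\<lambda>x X. \<eta> x (solder (s x) X))"
    unfolding smooth_form1_def
  proof (intro conjI ballI allI)
    fix x X show "\<eta> x (solder (s x) X) \<in> h (int p)"
      unfolding \<eta>_def by (intro subspace_sum[OF subspace_h] subspace_scale[OF subspace_h] RS)
  next
    fix x X Y a b assume "x \<in> U" "X \<in> tangent_space A x" "Y \<in> tangent_space A x"
    then show "\<eta> x (solder (s x) (\<lambda>c. a *\<^sub>R X c + b *\<^sub>R Y c)) = a *\<^sub>R \<eta> x (solder (s x) X) + b *\<^sub>R \<eta> x (solder (s x) Y)"
      by (simp add: solder_lincomb[OF frame_s] linear_add[OF \<eta>_lin] linear_scale[OF \<eta>_lin])
  next
    fix c v assume c: "c \<in> A"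
    note o = chart_open_image[OF c U_open]
    have "smooth_on (snd c ` (U \<inter> fst c)) (\<lambda>y. C (chart_inv c y))"
      by (intro smooth_on_vec[OF o]) (simp add: C_def curv_smooth[OF c])
    then have "smooth_on (snd c ` (U \<inter> fst c)) (\<lambda>y. R (C (chart_inv c y)) $ i)" for i
      by (intro smooth_on_nth[OF o] smooth_on_linear[OF R(2) o])
    then show "smooth_on (snd c ` (U \<inter> fst c))
       (\<lambda>y. \<eta> (chart_inv c y) (solder (s (chart_inv c y)) (coord_vec A c (chart_inv c y) v)))"
      unfolding \<eta>_def
      by (intro smooth_on_sum[OF o] smooth_on_scaleR[OF o] smooth_on_nth[OF o solder_smooth[OF c]])
  qed
  \<comment> \<open>The curvature of degree q involves forms of degree at most q only, so a new form
    in degree p changes none of the equations already satisfied.\<close>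
  have full': "full_tuple e s \<omega>' r = full r" if "r < int p" for r
    using that by (simp add: full_tuple_def \<omega>'_def)
  have total': "total_curvature A br e s \<omega>' q x X Y = total_curvature A br e s \<omega> q x X Y" if "q < int p" for q x X Y
    unfolding total_curvature_def using that full' by (auto intro!: sum.cong)
  have "admissible A P br h e (p + 1) U s \<omega>'"
    unfolding admissible_def
  proof (intro conjI ballI)
    show "open U" by (rule U_open)
    show "smooth_section A P U s" by (rule smooth_s)
    fix r assume r: "r \<in> {0..int (p + 1) - 1}"
    show "smooth_form1 A U (h r) (\<omega>' r)"
    proof (cases "r = int p")
      case True
      then show ?thesis using smooth\<eta> by (simp add: \<omega>'_def)
    next
      case False
      then have "r \<in> {0..int p - 1}" using r by auto
      from form_smooth[OF this] show ?thesis using False by (simp add: \<omega>'_def)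
    qed
  next
    fix q x X Y assume q: "q \<in> {0..int (p + 1) - 1}" and x: "x \<in> U"
      and XY: "X \<in> tangent_space A x" "Y \<in> tangent_space A x"
    have T: "total_curvature A br e s \<omega>' (q - 1) x X Y = total_curvature A br e s \<omega> (q - 1) x X Y"
      by (rule total') (use q in auto)
    have F: "full_tuple e s \<omega>' (-1) = full (-1)" by (rule full') simp
    show "total_curvature A br e s \<omega>' (q - 1) x X Y = - bracket_form br (full_tuple e s \<omega>' (-1)) (\<omega>' q) x X Y"
    proof (cases "q = int p")
      case True
      have "total_curvature A br e s \<omega> (q - 1) x X Y = curv x (solder (s x) X) (solder (s x) Y)"
        unfolding curv_def by (simp add: True frame_solder[OF frame_s[OF x]] XY)
      also have "\<dots> = - bracket_form br (full (-1)) (\<omega>' q) x X Y"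
        unfolding curv_eq[OF x] bracket_form_def
        using br_swap[of "e (solder (s x) X)" "\<eta> x (solder (s x) Y)"] br_swap[of "e (solder (s x) Y)" "\<eta> x (solder (s x) X)"]
        by (simp add: full_tuple_def \<omega>'_def True)
      finally show ?thesis unfolding T F .
    next
      case False
      then have "q \<in> {0..int p - 1}" using q by auto
      from admissible_equation[OF this x XY]
      have "total_curvature A br e s \<omega> (q - 1) x X Y = - bracket_form br (full (-1)) (\<omega> q) x X Y" .
      then show ?thesis unfolding T F using False by (simp add: \<omega>'_def)
    qed
  qed
  then show ?thesis by blast
qed

end

section \<open>Cochains and cohomology classes\<close>

lemma subspace_set_plus: "subspace N \<Longrightarrow> N + N = N"
  using subspace_0 subspace_add by (force simp: set_plus_def)

lemma coset_eq_subspace: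
  assumes "subspace N" "X \<in> N"
  shows "X +o N = N"
proof
  show "X +o N \<subseteq> N" using assms by (auto simp: elt_set_plus_def subspace_add)
  show "N \<subseteq> X +o N"
  proof
    fix Y assume "Y \<in> N"
    then have "Y - X \<in> N" "Y = X + (Y - X)" using assms by (auto simp: subspace_diff)
    then show "Y \<in> X +o N" unfolding elt_set_plus_def by blast
  qed
qed

lemma coset_add:
  fixes N :: "'a::real_vector set"
  shows "subspace N \<Longrightarrow> (X +o N) + (Y +o N) = (X + Y) +o N"
  by (simp add: set_plus_rearrange subspace_set_plus)

text \<open>The image of N under f may be smaller than N' (for multiplication by 0 it is a point);
  adding N' once more completes the image to a full coset.\<close>

lemma coset_image:
  assumes "linear f" "f ` N \<subseteq> N'" "subspace N" "subspace N'"
  shows "f ` (X +o N) + N' = f X +o N'"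
proof
  show "f ` (X +o N) + N' \<subseteq> f X +o N'"
    using assms by (auto simp: set_plus_def elt_set_plus_def linear_add add.assoc image_subset_iff
        intro!: subspace_add)
  show "f X +o N' \<subseteq> f ` (X +o N) + N'"
  proof
    fix Y assume "Y \<in> f X +o N'"
    then obtain Z where "Z \<in> N'" "Y = f X + Z" by (auto simp: elt_set_plus_def)
    moreover have "X \<in> X +o N" using subspace_0[OF assms(3)] by (force simp: elt_set_plus_def)
    ultimately show "Y \<in> f ` (X +o N) + N'" by blast
  qed
qed

lemma coset_scale:
  assumes "subspace N"
  shows "(\<lambda>Z. a *\<^sub>R Z) ` (X +o N) + N = (a *\<^sub>R X) +o N"
  by (rule coset_image) (use assms in \<open>auto simp: subspace_scale scaleR_right_distrib intro!: linearI\<close>)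

lemma coset_singleton: "X +o {0} = {X}" for X :: "'a::real_vector"
  by (simp add: elt_set_plus_def)

context relative_bracket
begin

lemma foldl_br_linear: "linear (\<lambda>X. foldl (\<lambda>Y w. br Y (e w)) X ws)"
proof (induction ws rule: rev_induct)
  case Nil
  show ?case by (simp add: linear_id[unfolded id_def])
next
  case (snoc w ws)
  show ?case
    by (intro linearI) (simp_all add: linear_add[OF snoc] linear_scale[OF snoc] br_add_left br_scale_left)
qed

lemma subspace_annihilator: "subspace (annihilator br h e l r)"
proof -
  have "subspace {X \<in> h l. \<forall>ws. length ws = r \<longrightarrow> foldl (\<lambda>Y w. br Y (e w)) X ws = 0}"
    by (intro subspaceI)
      (auto simp: linear_0[OF foldl_br_linear] linear_add[OF foldl_br_linear] linear_scale[OF foldl_br_linear]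
        subspace_0[OF subspace_h] subspace_add[OF subspace_h] subspace_scale[OF subspace_h])
  then show ?thesis by (simp add: annihilator_def subspace_h)
qed

lemma annihilator_0: "annihilator br h e l 0 = {0}"
  by (auto simp: annihilator_def subspace_0[OF subspace_h])

text \<open>An r-fold bracket of [X, w] is an (r+1)-fold bracket of X, whose first r steps already
  give 0. For l = 0 the target annihilator is {0} by convention, and r <= 1 forces [X, w] itself to
  vanish. For r = l + 1 > 1 the target is all of \<open>h (l - 1)\<close>.\<close>

lemma br_annihilator:
  assumes X: "X \<in> annihilator br h e l r" and r: "int r \<le> l + 1"
  shows "br X (e w) \<in> annihilator br h e (l - 1) r"
proof (cases "l < 0")
  case True
  then have "br X (e w) = 0" using X by (simp add: annihilator_def br_zero_left)
  then show ?thesis by (simp add: subspace_0[OF subspace_annihilator])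
next
  case False
  then have X: "X \<in> h l" "\<And>ws. length ws = r \<Longrightarrow> foldl (\<lambda>Y w. br Y (e w)) X ws = 0"
    using X r by (simp_all add: annihilator_def)
  have brh: "br X (e w) \<in> h (l - 1)" using br_h[OF X(1) e_h[of w]] by simp
  show ?thesis
  proof (cases "l = 0")
    case True
    have "br X (e w) = 0"
    proof (cases "r = 0")
      case True
      then show ?thesis using X(2)[of "[]"] by (simp add: br_zero_left)
    next
      case False
      then have "r = 1" using r \<open>l = 0\<close> by simp
      then show ?thesis using X(2)[of "[w]"] by simp
    qed
    then show ?thesis by (simp add: subspace_0[OF subspace_annihilator])
  next
    case l: False
    \<comment> \<open>The list \<open>w # ws\<close> has r + 1 entries and is cut after the first r,
      where the bracket is already 0.\<close>
    have "foldl (\<lambda>Y w. br Y (e w)) (br X (e w)) ws = 0" if "length ws = r" for ws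
    proof -
      have "foldl (\<lambda>Y w. br Y (e w)) (br X (e w)) ws =
          foldl (\<lambda>Y w. br Y (e w)) X (take r (w # ws) @ drop r (w # ws))" by simp
      also have "\<dots> = foldl (\<lambda>Y w. br Y (e w)) 0 (drop r (w # ws))"
        unfolding foldl_append using X(2)[of "take r (w # ws)"] that by simp
      also have "\<dots> = 0" by (rule linear_0[OF foldl_br_linear])
      finally show ?thesis .
    qed
    then show ?thesis using brh l False by (simp add: annihilator_def)
  qed
qed

lemma coset_bracket:
  assumes "int r \<le> l + 1"
  shows "(\<lambda>X. t *\<^sub>R br X (e w)) ` (X +o annihilator br h e l r) + annihilator br h e (l - 1) r =
    (t *\<^sub>R br X (e w)) +o annihilator br h e (l - 1) r"
proof (rule coset_image)
  show "linear (\<lambda>X. t *\<^sub>R br X (e w))"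
    by (intro linearI) (simp_all add: br_add_left br_scale_left scaleR_right_distrib)
  show "(\<lambda>X. t *\<^sub>R br X (e w)) ` annihilator br h e l r \<subseteq> annihilator br h e (l - 1) r"
    using br_annihilator[OF _ assms] subspace_scale[OF subspace_annihilator] by blast
qed (rule subspace_annihilator)+

text \<open>At level 0 the cosets are singletons, so an honest linear map is wrapped into a cochain
  by taking singletons of its values.\<close>

definition cochain1 :: "(real^'n \<Rightarrow> 'e) \<Rightarrow> (real^'n) list \<Rightarrow> 'e set" where
  "cochain1 \<eta> = (\<lambda>ws\<in>{ws. length ws = 1}. {\<eta> (ws ! 0)})"

definition cobdry1 :: "(real^'n \<Rightarrow> 'e) \<Rightarrow> (real^'n) list \<Rightarrow> 'e set" where
  "cobdry1 \<eta> = (\<lambda>ws\<in>{ws. length ws = 2}. {br (\<eta> (ws ! 0)) (e (ws ! 1)) - br (\<eta> (ws ! 1)) (e (ws ! 0))})"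

text \<open>With a single argument the alternation condition is vacuous, and multilinearity is
  linearity of the unique element of each coset.\<close>

lemma cochains_1:
  "cochains br h e (int p + 1) 1 0 = {cochain1 \<eta> | \<eta>. linear \<eta> \<and> (\<forall>v. \<eta> v \<in> h (int p))}"
proof (intro equalityI subsetI)
  fix c assume "c \<in> cochains br h e (int p + 1) 1 0"
  then have c: "c \<in> {ws. length ws = 1} \<rightarrow>\<^sub>E {{X} | X. X \<in> h (int p)}"
    and lin: "\<And>ws i a b v w. length ws = 1 \<and> i < 1 \<Longrightarrow>
      c (ws[i := a *\<^sub>R v + b *\<^sub>R w]) = ((\<lambda>X. a *\<^sub>R X) ` c (ws[i := v]) + {0}) + ((\<lambda>X. b *\<^sub>R X) ` c (ws[i := w]) + {0})"
    unfolding cochains_def Let_def by (simp_all add: annihilator_0 coset_singleton)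
  define \<eta> where "\<eta> v = the_elem (c [v])" for v
  have \<eta>: "c [v] = {\<eta> v} \<and> \<eta> v \<in> h (int p)" for v
  proof -
    have "c [v] \<in> {{X} | X. X \<in> h (int p)}" using c by (rule PiE_mem) simp
    then obtain X where "c [v] = {X}" "X \<in> h (int p)" by blast
    then show ?thesis by (simp add: \<eta>_def)
  qed
  have "\<eta> (a *\<^sub>R v + b *\<^sub>R w) = a *\<^sub>R \<eta> v + b *\<^sub>R \<eta> w" for a b v w
    using lin[of "[v]" 0 a v b w] by (simp add: \<eta> set_plus_def)
  from this[of 1 _ 1] this[of _ _ 0 0] have "linear \<eta>" by (intro linearI) auto
  moreover have "c = cochain1 \<eta>"
  proof
    fix ws show "c ws = cochain1 \<eta> ws"
    proof (cases "length ws = 1")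
      case True
      then obtain v where "ws = [v]" by (auto simp: length_Suc_conv)
      then show ?thesis by (simp add: cochain1_def \<eta>)
    next
      case False
      then show ?thesis using PiE_arb[OF c, of ws] by (simp add: cochain1_def)
    qed
  qed
  ultimately show "c \<in> {cochain1 \<eta> | \<eta>. linear \<eta> \<and> (\<forall>v. \<eta> v \<in> h (int p))}" using \<eta> by blast
next
  fix c assume "c \<in> {cochain1 \<eta> | \<eta>. linear \<eta> \<and> (\<forall>v. \<eta> v \<in> h (int p))}"
  then obtain \<eta> where c: "c = cochain1 \<eta>" and \<eta>: "linear \<eta>" "\<And>v. \<eta> v \<in> h (int p)" by blast
  show "c \<in> cochains br h e (int p + 1) 1 0"
    unfolding cochains_def Let_def c
  proof (intro CollectI conjI allI impI)
    show "cochain1 \<eta> \<in> {ws. length ws = 1} \<rightarrow>\<^sub>E {X +o annihilator br h e (int p + 1 - 1) 0 | X. X \<in> h (int p + 1 - 1)}"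
      using \<eta>(2) by (auto simp: cochain1_def annihilator_0 coset_singleton)
  next
    fix ws :: "(real^'n) list" and i :: nat and a b v w
    assume "length ws = 1 \<and> i < 1"
    then show "cochain1 \<eta> (ws[i := a *\<^sub>R v + b *\<^sub>R w]) =
        ((\<lambda>X. a *\<^sub>R X) ` cochain1 \<eta> (ws[i := v]) + annihilator br h e (int p + 1 - 1) 0) +
        ((\<lambda>X. b *\<^sub>R X) ` cochain1 \<eta> (ws[i := w]) + annihilator br h e (int p + 1 - 1) 0)"
      by (simp add: cochain1_def annihilator_0 linear_add[OF \<eta>(1)] linear_scale[OF \<eta>(1)] set_plus_def)
  qed auto
qed

lemma cobdry_cochain1: "cobdry br h e (int p + 1) 1 0 (cochain1 \<eta>) = cobdry1 \<eta>"
proof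
  fix ws :: "(real^'n) list"
  show "cobdry br h e (int p + 1) 1 0 (cochain1 \<eta>) ws = cobdry1 \<eta> ws"
  proof (cases "length ws = 2")
    case True
    then obtain v w where ws: "ws = [v, w]" by (auto simp: length_Suc_conv numeral_2_eq_2)
    have "{0..1::nat} = {0, 1}" by auto
    then show ?thesis
      by (simp add: cobdry_def cobdry1_def cochain1_def ws annihilator_0 set_plus_def)
  qed (simp add: cobdry_def cobdry1_def)
qed

lemma coboundaries_2:
  "coboundaries br h e (int p) 2 0 = {cobdry1 \<eta> | \<eta>. linear \<eta> \<and> (\<forall>v. \<eta> v \<in> h (int p))}"
proof -
  have "coboundaries br h e (int p) 2 0 = cobdry br h e (int p + 1) 1 0 ` cochains br h e (int p + 1) 1 0"
    by (simp add: coboundaries_def)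
  then show ?thesis by (simp only: cochains_1 setcompr_eq_image image_image cobdry_cochain1)
qed

lemma cobdry1_add:
  "(\<lambda>ws\<in>{ws. length ws = 2}. cobdry1 \<eta> ws + cobdry1 \<zeta> ws) = cobdry1 (\<lambda>v. \<eta> v + \<zeta> v)"
  by (rule ext) (simp add: cobdry1_def set_plus_def br_add_left)

text \<open>The unit of the quotient is the set of coboundaries itself, so the class is trivial iff
  translation by c maps this set onto itself, that is, iff c belongs to it. The \<eta> on the right
  is minus a primitive of c: with this sign it can serve directly as the next form
  \<omega>^p.\<close>

lemma cohomology_class_trivial_iff:
  assumes c: "c = (\<lambda>ws\<in>{ws. length ws = 2}. {f (ws ! 0) (ws ! 1)})"
  shows "cohomology_class br h e (int p) 2 0 c = \<one>\<^bsub>cohomology_group br h e (int p) 2 0\<^esub> \<longleftrightarrow>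
    (\<exists>\<eta>. linear \<eta> \<and> (\<forall>v. \<eta> v \<in> h (int p)) \<and> (\<forall>v w. f v w = br (\<eta> w) (e v) - br (\<eta> v) (e w)))"
proof -
  let ?B = "coboundaries br h e (int p) 2 0"
  define m where "m b d = (\<lambda>ws\<in>{ws. length ws = 2}. b ws + d ws)" for b d :: "(real^'n) list \<Rightarrow> 'e set"
  have "cohomology_class br h e (int p) 2 0 c = \<one>\<^bsub>cohomology_group br h e (int p) 2 0\<^esub> \<longleftrightarrow>
      (\<lambda>b. m b c) ` ?B = ?B"
    unfolding cohomology_class_def cohomology_group_def FactGroup_def r_coset_def cocycle_group_def m_def
    by (simp add: UNION_singleton_eq_range)
  also have "\<dots> \<longleftrightarrow> c \<in> ?B"
  proof
    assume eq: "(\<lambda>b. m b c) ` ?B = ?B"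
    \<comment> \<open>Translating the zero coboundary by c gives c back.\<close>
    have "cobdry1 (\<lambda>v. 0) \<in> ?B"
      unfolding coboundaries_2 using subspace_0[OF subspace_h] linear_zero by blast
    then have "m (cobdry1 (\<lambda>v. 0)) c \<in> ?B" using eq by blast
    moreover have "m (cobdry1 (\<lambda>v. 0)) c = c"
      by (rule ext) (simp add: m_def c cobdry1_def br_zero_left set_plus_def)
    ultimately show "c \<in> ?B" by simp
  next
    assume "c \<in> ?B"
    then obtain \<zeta> where \<zeta>: "c = cobdry1 \<zeta>" "linear \<zeta>" "\<And>v. \<zeta> v \<in> h (int p)" unfolding coboundaries_2 by blast
    show "(\<lambda>b. m b c) ` ?B = ?B"
    proof (intro equalityI subsetI)
      fix d assume "d \<in> (\<lambda>b. m b c) ` ?B"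
      then obtain \<eta> where \<eta>: "d = m (cobdry1 \<eta>) c" "linear \<eta>" "\<And>v. \<eta> v \<in> h (int p)"
        unfolding coboundaries_2 by blast
      have "d = cobdry1 (\<lambda>v. \<eta> v + \<zeta> v)" unfolding \<eta>(1) \<zeta>(1) m_def by (rule cobdry1_add)
      moreover have "linear (\<lambda>v. \<eta> v + \<zeta> v)" by (rule linear_compose_add[OF \<eta>(2) \<zeta>(2)])
      ultimately show "d \<in> ?B"
        unfolding coboundaries_2 using subspace_add[OF subspace_h \<eta>(3) \<zeta>(3)] by blast
    next
      fix d assume "d \<in> ?B"
      then obtain \<eta> where \<eta>: "d = cobdry1 \<eta>" "linear \<eta>" "\<And>v. \<eta> v \<in> h (int p)"
        unfolding coboundaries_2 by blast
      have "d = m (cobdry1 (\<lambda>v. \<eta> v - \<zeta> v)) c" unfolding \<eta>(1) \<zeta>(1) m_def cobdry1_add by simp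
      moreover have "cobdry1 (\<lambda>v. \<eta> v - \<zeta> v) \<in> ?B"
        unfolding coboundaries_2
        using linear_compose_sub[OF \<eta>(2) \<zeta>(2)] subspace_diff[OF subspace_h \<eta>(3) \<zeta>(3)] by blast
      ultimately show "d \<in> (\<lambda>b. m b c) ` ?B" by blast
    qed
  qed
  also have "\<dots> \<longleftrightarrow> (\<exists>\<eta>. linear \<eta> \<and> (\<forall>v. \<eta> v \<in> h (int p)) \<and> (\<forall>v w. f v w = br (\<eta> w) (e v) - br (\<eta> v) (e w)))"
  proof
    assume "c \<in> ?B"
    then obtain \<eta> where \<eta>: "c = cobdry1 \<eta>" "linear \<eta>" "\<And>v. \<eta> v \<in> h (int p)" unfolding coboundaries_2 by blast
    \<comment> \<open>The arguments stand in the opposite order in \<open>cobdry1\<close>, so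
      passing from one convention to the other negates \<eta>.\<close>
    have "f v w = br (- \<eta> w) (e v) - br (- \<eta> v) (e w)" for v w
      using fun_cong[OF \<eta>(1), of "[v, w]"] by (simp add: c cobdry1_def br_neg_left)
    moreover have "linear (\<lambda>v. - \<eta> v)" by (rule linear_compose_neg[OF \<eta>(2)])
    moreover have "- \<eta> v \<in> h (int p)" for v by (rule subspace_neg[OF subspace_h \<eta>(3)])
    ultimately show "\<exists>\<eta>. linear \<eta> \<and> (\<forall>v. \<eta> v \<in> h (int p)) \<and> (\<forall>v w. f v w = br (\<eta> w) (e v) - br (\<eta> v) (e w))"
      by (intro exI[of _ "\<lambda>v. - \<eta> v"]) simp
  next
    assume "\<exists>\<eta>. linear \<eta> \<and> (\<forall>v. \<eta> v \<in> h (int p)) \<and> (\<forall>v w. f v w = br (\<eta> w) (e v) - br (\<eta> v) (e w))"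
    then obtain \<eta> where \<eta>: "linear \<eta>" "\<And>v. \<eta> v \<in> h (int p)" "\<And>v w. f v w = br (\<eta> w) (e v) - br (\<eta> v) (e w)" by blast
    have "c = cobdry1 (\<lambda>v. - \<eta> v)"
      by (rule ext) (simp add: c cobdry1_def \<eta>(3) br_neg_left)
    moreover have "linear (\<lambda>v. - \<eta> v)" by (rule linear_compose_neg[OF \<eta>(1)])
    ultimately show "c \<in> ?B" unfolding coboundaries_2 using subspace_neg[OF subspace_h \<eta>(2)] by blast
  qed
  finally show ?thesis .
qed

end

section \<open>The curvature as a cocycle, and the meaning of its class\<close>

context admissible_tuple
begin

lemma curvature_cochain_eq:
  "curvature_cochain A br h e s \<omega> (int p) r x =
     (\<lambda>ws\<in>{ws. length ws = 2}. curv x (ws ! 0) (ws ! 1) +o annihilator br h e (int p - 1) r)"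
  unfolding curvature_cochain_def curv_def ..

lemma curvature_in_cochains:
  assumes x: "x \<in> U"
  shows "curvature_cochain A br h e s \<omega> (int p) r x \<in> cochains br h e (int p) 2 r"
proof -
  let ?N = "annihilator br h e (int p - 1) r"
  note N = subspace_annihilator[of "int p - 1" r]
  note bil = bilinear_ladd[OF curv_bilinear[OF x]] bilinear_radd[OF curv_bilinear[OF x]]
    bilinear_lmul[OF curv_bilinear[OF x]] bilinear_rmul[OF curv_bilinear[OF x]]
  show ?thesis
    unfolding cochains_def Let_def curvature_cochain_eq
  proof (intro CollectI conjI allI impI)
    show "(\<lambda>ws\<in>{ws. length ws = 2}. curv x (ws ! 0) (ws ! 1) +o ?N) \<in>
        {ws. length ws = 2} \<rightarrow>\<^sub>E {X +o ?N | X. X \<in> h (int p - 1)}"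
      using curv_h[OF x] by auto
  next
    fix ws :: "(real^'n) list" and i :: nat and a b v w
    assume "length ws = 2 \<and> i < 2"
    then obtain u u' where ws: "ws = [u, u']" and i: "i = 0 \<or> i = 1"
      by (auto simp: length_Suc_conv numeral_2_eq_2 less_Suc_eq)
    show "(\<lambda>ws\<in>{ws. length ws = 2}. curv x (ws ! 0) (ws ! 1) +o ?N) (ws[i := a *\<^sub>R v + b *\<^sub>R w]) =
        ((\<lambda>X. a *\<^sub>R X) ` (\<lambda>ws\<in>{ws. length ws = 2}. curv x (ws ! 0) (ws ! 1) +o ?N) (ws[i := v]) + ?N) +
        ((\<lambda>X. b *\<^sub>R X) ` (\<lambda>ws\<in>{ws. length ws = 2}. curv x (ws ! 0) (ws ! 1) +o ?N) (ws[i := w]) + ?N)"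
      using i by (elim disjE) (simp_all add: ws coset_scale[OF N] coset_add[OF N] bil)
  next
    fix ws :: "(real^'n) list" and i l :: nat
    assume "length ws = 2 \<and> i < l \<and> l < 2 \<and> ws ! i = ws ! l"
    then obtain u where ws: "ws = [u, u]"
      by (auto simp: length_Suc_conv numeral_2_eq_2 less_Suc_eq)
    show "(\<lambda>ws\<in>{ws. length ws = 2}. curv x (ws ! 0) (ws ! 1) +o ?N) ws = ?N"
      by (simp add: ws curv_self coset_eq_subspace[OF N subspace_0[OF N]])
  qed
qed

text \<open>Up to the sign -1 and one exchange of arguments, the three alternating terms form the
  cyclic sum in \<open>curvature_bianchi\<close>. The bound r <= p is the condition under which the
  bracket maps cosets in degree p - 1 to cosets in degree p - 2.\<close>

lemma curvature_cocycle:
  assumes x: "x \<in> U" and r: "r \<le> p"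
  shows "cobdry br h e (int p) 2 r (curvature_cochain A br h e s \<omega> (int p) r x) =
    zero_cochain br h e (int p - 1) 3 r"
proof
  fix ws :: "(real^'n) list"
  let ?N = "annihilator br h e (int p - 1) r" and ?N' = "annihilator br h e (int p - 2) r"
  note N' = subspace_annihilator[of "int p - 2" r]
  have cb: "(\<lambda>X. t *\<^sub>R br X (e w)) ` (X +o ?N) + ?N' = (t *\<^sub>R br X (e w)) +o ?N'" for t w X
    using coset_bracket[of r "int p - 1" t w X] r by simp
  show "cobdry br h e (int p) 2 r (curvature_cochain A br h e s \<omega> (int p) r x) ws =
    zero_cochain br h e (int p - 1) 3 r ws"
  proof (cases "length ws = 3")
    case True
    then obtain u v w where ws: "ws = [u, v, w]" by (auto simp: length_Suc_conv numeral_3_eq_3)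
    let ?C = "\<lambda>i X z. (\<lambda>X. (-1) ^ (i + 1) *\<^sub>R br X (e z)) ` (X +o ?N) + ?N'"
    have I: "{0..2::nat} = {0, 1, 2}" by auto
    have "cobdry br h e (int p) 2 r (curvature_cochain A br h e s \<omega> (int p) r x) ws =
      ?C (0::nat) (curv x v w) u + (?C (1::nat) (curv x u w) v + ?C (2::nat) (curv x u v) w)"
      by (simp add: cobdry_def curvature_cochain_eq ws I del: power_Suc)
    also have "\<dots> = ((-1) ^ (0 + 1) *\<^sub>R br (curv x v w) (e u) + ((-1) ^ (1 + 1) *\<^sub>R br (curv x u w) (e v)
       + (-1) ^ (2 + 1) *\<^sub>R br (curv x u v) (e w))) +o ?N'"
      unfolding cb coset_add[OF N'] ..
    also have "(-1) ^ (0 + 1) *\<^sub>R br (curv x v w) (e u) + ((-1) ^ (1 + 1) *\<^sub>R br (curv x u w) (e v)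
       + (-1) ^ (2 + 1) *\<^sub>R br (curv x u v) (e w)) =
       - (br (curv x u v) (e w) + br (curv x v w) (e u) + br (curv x w u) (e v))"
      unfolding curv_swap[OF x, of u w] by (simp add: br_neg_left)
    also have "\<dots> = 0" using curvature_bianchi[OF x, of u v w] by (simp add: curv_def)
    also have "0 +o ?N' = ?N'" by (rule coset_eq_subspace[OF N' subspace_0[OF N']])
    finally show ?thesis by (simp add: zero_cochain_def ws)
  qed (simp add: cobdry_def zero_cochain_def)
qed

lemma curvature_class_trivial_iff:
  "cohomology_class br h e (int p) 2 0 (curvature_cochain A br h e s \<omega> (int p) 0 x) =
     \<one>\<^bsub>cohomology_group br h e (int p) 2 0\<^esub> \<longleftrightarrow>
   (\<exists>\<eta>. linear \<eta> \<and> (\<forall>v. \<eta> v \<in> h (int p)) \<and> (\<forall>v w. curv x v w = br (\<eta> w) (e v) - br (\<eta> v) (e w)))"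
  by (rule cohomology_class_trivial_iff) (simp add: curvature_cochain_eq annihilator_0 coset_singleton)

text \<open>The converse of the extension step: the admissibility equation of index q = p, read in
  the frame \<open>s x\<close>, exhibits \<omega>^p at x as the required linear map.\<close>

lemma next_form_primitive:
  assumes adm': "admissible A P br h e (p + 1) U s \<omega>" and x: "x \<in> U"
  shows "\<exists>\<eta>. linear \<eta> \<and> (\<forall>v. \<eta> v \<in> h (int p)) \<and> (\<forall>v w. curv x v w = br (\<eta> w) (e v) - br (\<eta> v) (e w))"
proof -
  interpret tuple': admissible_tuple A br h k e P "p + 1" U s \<omega>
    using adm' frames by unfold_locales
  have p: "int p \<in> {0..int (p + 1) - 1}" by simp
  note f = frame_s[OF x] and T = frame_in[OF frame_s[OF x]]
  define \<eta> where "\<eta> v = \<omega> (int p) x (s x v)" for v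
  have "\<eta> (a *\<^sub>R v + b *\<^sub>R w) = a *\<^sub>R \<eta> v + b *\<^sub>R \<eta> w" for a b v w
    unfolding \<eta>_def frame_lincomb[OF f] by (rule form_lincomb[OF tuple'.form_smooth[OF p] x T T])
  from this[of 1 _ 1] this[of _ _ 0 0] have "linear \<eta>" by (intro linearI) auto
  moreover have "\<eta> v \<in> h (int p)" for v
    unfolding \<eta>_def by (rule form_value[OF tuple'.form_smooth[OF p] x T])
  moreover have "curv x v w = br (\<eta> w) (e v) - br (\<eta> v) (e w)" for v w
    unfolding curv_def tuple'.admissible_equation[OF p x T T] bracket_form_def full_solder[OF x] \<eta>_def[symmetric]
    using br_swap[of "e v" "\<eta> w"] br_swap[of "e w" "\<eta> v"] by simp
  ultimately show ?thesis by blast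
qed

end

lemma admissible_lower:
  assumes "admissible A P br h e (p + 1) U s \<omega>"
  shows "admissible A P br h e p U s \<omega>"
proof -
  have "{0..int p - 1} \<subseteq> {0..int (p + 1) - 1}" by auto
  then show ?thesis using assms unfolding admissible_def by blast
qed

lemma linear_W_incl: "linear (W_incl i)"
  by (intro linearI) (auto simp: W_incl_def vec_eq_iff)

theorem theorem3p4:
  fixes H :: "'h::{t2_space,second_countable_topology} monoid"
    and AH :: "('h, 'e::euclidean_space) chart set"
    and K :: "'h set"
    and AMt :: "('mt::{t2_space,second_countable_topology}, real^'N) chart set"
    and act :: "'h \<Rightarrow> 'mt \<Rightarrow> 'mt"
    and x0 :: 'mt
    and u0 :: "('mt, real^'N) frame"
    and Gt :: "(real^'N^'N) set"
    and Pt :: "('mt \<times> ('mt, real^'N) frame) set"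
    and br :: "'e \<Rightarrow> 'e \<Rightarrow> 'e"
    and \<epsilon> :: "('h, 'e) frame"
    and k p :: nat
    and h :: "int \<Rightarrow> 'e set"
    and \<theta> :: "real^'N \<Rightarrow> 'e"
    and j :: "'n::finite \<Rightarrow> 'N::finite"
    and A :: "('m::{t2_space,second_countable_topology}, real^'n) chart set"
    and G :: "(real^'n^'n) set"
    and P :: "('m \<times> ('m, real^'n) frame) set"
    and e :: "real^'n \<Rightarrow> 'e"
  assumes "flat_k_reductive H AH K AMt act x0 u0 Gt Pt br \<epsilon> k h \<theta>"
    and "inj j"
    and "e = \<theta> \<circ> W_incl j"
    and "smooth_atlas A"
    and "G = upper_left_blocks j (G_sharp j Gt)"
    and "G_structure A G P"
    and "locally_immersible A P br h e p"
  shows "(\<forall>U s \<omega>. admissible A P br h e p U s \<omega> \<longrightarrow>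
            (\<forall>x\<in>U.
               curvature_cochain A br h e s \<omega> (int p) 0 x \<in> cochains br h e (int p) 2 0 \<and>
               cobdry br h e (int p) 2 0 (curvature_cochain A br h e s \<omega> (int p) 0 x) =
                 zero_cochain br h e (int p - 1) 3 0 \<and>
               (\<forall>r\<in>{1..p}.
                  curvature_cochain A br h e s \<omega> (int p) r x \<in> cochains br h e (int p) 2 r \<and>
                  cobdry br h e (int p) 2 r (curvature_cochain A br h e s \<omega> (int p) r x) =
                    zero_cochain br h e (int p - 1) 3 r))) \<and>
         (locally_immersible A P br h e (p + 1) \<longleftrightarrow>
            (\<forall>xo. \<exists>U s \<omega>. xo \<in> U \<and> admissible A P br h e p U s \<omega> \<and>
               (\<forall>x\<in>U.
                  cohomology_class br h e (int p) 2 0 (curvature_cochain A br h e s \<omega> (int p) 0 x) =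
                    \<one>\<^bsub>cohomology_group br h e (int p) 2 0\<^esub>)))"
proof -
  interpret flat: flat_k_reductive H AH K AMt act x0 u0 Gt Pt br \<epsilon> k h \<theta> by (rule assms(1))
  interpret smooth_manifold A by unfold_locales (rule assms(4))
  have "linear e" unfolding assms(3) by (rule linear_compose[OF linear_W_incl flat.identification(1)])
  moreover have "e w \<in> h (-1)" for w
    using flat.identification(2) unfolding assms(3) bij_betw_def by auto
  ultimately interpret relative_bracket br h k e
    by (intro relative_bracket.intro graded_bracket.intro relative_bracket_axioms.intro flat.graded)
  have frames: "P \<subseteq> frame_bundle A" using assms(6) by (simp add: G_structure_def)
  have tuple: "admissible_tuple A br h k e P p U s \<omega>" if "admissible A P br h e p U s \<omega>" for U s \<omega>
    using frames that by unfold_locales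
  show ?thesis
  proof (intro conjI allI impI ballI iffI)
    fix U s \<omega> x assume "admissible A P br h e p U s \<omega>" and x: "x \<in> U"
    then interpret admissible_tuple A br h k e P p U s \<omega> by (intro tuple)
    show "curvature_cochain A br h e s \<omega> (int p) 0 x \<in> cochains br h e (int p) 2 0"
      by (rule curvature_in_cochains[OF x])
    show "cobdry br h e (int p) 2 0 (curvature_cochain A br h e s \<omega> (int p) 0 x) =
        zero_cochain br h e (int p - 1) 3 0"
      by (rule curvature_cocycle[OF x]) simp
    fix r assume r: "r \<in> {1..p}"
    show "curvature_cochain A br h e s \<omega> (int p) r x \<in> cochains br h e (int p) 2 r"
      by (rule curvature_in_cochains[OF x])
    show "cobdry br h e (int p) 2 r (curvature_cochain A br h e s \<omega> (int p) r x) =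
        zero_cochain br h e (int p - 1) 3 r"
      by (rule curvature_cocycle[OF x]) (use r in simp)
  next
    fix xo assume "locally_immersible A P br h e (p + 1)"
    \<comment> \<open>Forgetting \<omega>^p turns a tuple of order p + 1 into one of order p, and
      the forgotten form trivializes its curvature class at every point of U.\<close>
    then obtain U s \<omega> where U: "xo \<in> U" and adm': "admissible A P br h e (p + 1) U s \<omega>"
      unfolding locally_immersible_def by blast
    note adm = admissible_lower[OF adm']
    interpret admissible_tuple A br h k e P p U s \<omega> by (rule tuple[OF adm])
    have triv: "\<forall>x\<in>U. cohomology_class br h e (int p) 2 0 (curvature_cochain A br h e s \<omega> (int p) 0 x) =
        \<one>\<^bsub>cohomology_group br h e (int p) 2 0\<^esub>"
      unfolding curvature_class_trivial_iff using next_form_primitive[OF adm'] by blast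
    show "\<exists>U s \<omega>. xo \<in> U \<and> admissible A P br h e p U s \<omega> \<and>
        (\<forall>x\<in>U. cohomology_class br h e (int p) 2 0 (curvature_cochain A br h e s \<omega> (int p) 0 x) =
          \<one>\<^bsub>cohomology_group br h e (int p) 2 0\<^esub>)"
      by (intro exI[of _ U] exI[of _ s] exI[of _ \<omega>] conjI U adm triv)
  next
    assume *: "\<forall>xo. \<exists>U s \<omega>. xo \<in> U \<and> admissible A P br h e p U s \<omega> \<and>
        (\<forall>x\<in>U. cohomology_class br h e (int p) 2 0 (curvature_cochain A br h e s \<omega> (int p) 0 x) =
          \<one>\<^bsub>cohomology_group br h e (int p) 2 0\<^esub>)"
    show "locally_immersible A P br h e (p + 1)"
      unfolding locally_immersible_def
    proof
      fix xo
      from *[THEN spec, of xo] obtain U s \<omega> where U: "xo \<in> U" and adm: "admissible A P br h e p U s \<omega>"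
        and triv: "\<forall>x\<in>U. cohomology_class br h e (int p) 2 0 (curvature_cochain A br h e s \<omega> (int p) 0 x) =
          \<one>\<^bsub>cohomology_group br h e (int p) 2 0\<^esub>"
        by (elim exE conjE)
      interpret admissible_tuple A br h k e P p U s \<omega> by (rule tuple[OF adm])
      \<comment> \<open>The extension lives over the same U with the same section, so the
        neighbourhood of \<open>xo\<close> does not shrink.\<close>
      have "\<exists>\<omega>'. admissible A P br h e (p + 1) U s \<omega>'"
        by (rule extend_admissible) (rule curvature_class_trivial_iff[THEN iffD1, OF bspec[OF triv]])
      then obtain \<omega>' where "admissible A P br h e (p + 1) U s \<omega>'" by (elim exE)
      with U show "\<exists>U s \<omega>. xo \<in> U \<and> admissible A P br h e (p + 1) U s \<omega>"
        by (intro exI[of _ U] exI[of _ s] exI[of _ \<omega>'] conjI)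
    qed
  qed
qed

end
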